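(* Let $X$ be a $\frac{1}{4}$-homogeneous non-smooth fan with top $t$. Then: \begin{enumerate} \item $X$ is colocally connected at each point of $E(X)$; \item $E(X)$ is dense in $X$; and \item $S(X) \supset E(X) \cup \{t\}$ (inclusion, not necessarily proper). \end{enumerate}
   Context: All spaces are metric. A continuum is a compact connected metric space. A dendroid is an arcwise connected and hereditarily unicoherent continuum. In a dendroid $X$, for points $p,q \in X$, $pq$ denotes the unique arc in $X$ with endpoints $p$ and $q$ (with $pp=\{p\}$). A point $p$ of a dendroid $X$ has order $r$ (in the classical sense) if $p$ is a common endpoint of exactly $r$ arcs in $X$ which are disjoint from one another beyond $p$; $p$ is an endpoint if its order is $1$ and a ramification point if its order is greater than $2$ (possibly infinite). $E(X)$ denotes the set of endpoints of $X$. A fan is a dendroid with exactly one ramification point, called its top. A dendroid $X$ is smooth if there is a point $p \in X$ such that for each sequence $\{a_n\}_n$ of points of $X$ converging to a point $a \in X$, the arcs $pa_n$ converge to the arc $pa$ in the Hausdorff metric (in a smooth fan the top can always be used as $p$); non-smooth means not smooth. For a fan $X$ with top $t$ and $a \in X$, $X$ is smooth at $t$ with respect to $a$ if for every sequence $\{a_n\}_n$ in $X$ converging to $a$, $ta_n \to ta$ in the Hausdorff metric; $S(X) = \{a \in X : X \text{ is smooth at } t \text{ with respect to } a\}$. A space $X$ is $\frac{1}{n}$-homogeneous if the action of the group of homeomorphisms of $X$ onto itself on $X$ has exactly $n$ orbits. A space $X$ is colocally connected at a point $p \in X$ if each neighborhood of $p$ contains a neighborhood $V$ of $p$ such that $X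 - V$ is connected. *)

theory Defs
  imports "HOL-Analysis.Analysis" "HOL-Library.Extended_Nat"
begin

text \<open>
  A space is a subset \<open>X\<close> of a metric type, carrying the subspace metric; all notions are
  relative to \<open>X\<close>.
\<close>

definition continuum :: "'a::metric_space set \<Rightarrow> bool" where
  "continuum X \<longleftrightarrow> X \<noteq> {} \<and> compact X \<and> connected X"

definition arc_joining :: "'a::metric_space set \<Rightarrow> 'a \<Rightarrow> 'a \<Rightarrow> 'a set \<Rightarrow> bool" where
  "arc_joining X p q A \<longleftrightarrow>
     (\<exists>g. arc g \<and> pathstart g = p \<and> pathfinish g = q \<and> path_image g = A \<and> A \<subseteq> X)"

definition arcwise_connected :: "'a::metric_space set \<Rightarrow> bool" where
  "arcwise_connected X \<longleftrightarrow> (\<forall>p\<in>X. \<forall>q\<in>X. p \<noteq> q \<longrightarrow> (\<exists>A. arc_joining X p q A))"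

definition hereditarily_unicoherent :: "'a::metric_space set \<Rightarrow> bool" where
  "hereditarily_unicoherent X \<longleftrightarrow> (\<forall>K. K \<subseteq> X \<and> continuum K \<longrightarrow> unicoherent K)"

definition dendroid :: "'a::metric_space set \<Rightarrow> bool" where
  "dendroid X \<longleftrightarrow> continuum X \<and> arcwise_connected X \<and> hereditarily_unicoherent X"

text \<open>The arc \<open>pq\<close>; meaningful when \<open>X\<close> is a dendroid and \<open>p, q \<in> X\<close>.\<close>

definition the_arc :: "'a::metric_space set \<Rightarrow> 'a \<Rightarrow> 'a \<Rightarrow> 'a set" where
  "the_arc X p q = (if p = q then {p} else (THE A. arc_joining X p q A))"

text \<open>
  The order in the classical sense is the largest size of a family of arcs of \<open>X\<close> that have
  \<open>p\<close> as an endpoint and are pairwise disjoint beyond \<open>p\<close>. Infinite orders are not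
  distinguished from one another: all of them are \<open>\<infinity>\<close>.
\<close>

definition arc_star :: "'a::metric_space set \<Rightarrow> 'a \<Rightarrow> 'a set set \<Rightarrow> bool" where
  "arc_star X p \<A> \<longleftrightarrow>
     (\<forall>A\<in>\<A>. \<exists>q. arc_joining X p q A) \<and> pairwise (\<lambda>A B. A \<inter> B = {p}) \<A>"

definition classical_order :: "'a::metric_space set \<Rightarrow> 'a \<Rightarrow> enat" where
  "classical_order X p = (SUP \<A>\<in>{\<A>. finite \<A> \<and> arc_star X p \<A>}. enat (card \<A>))"

definition end_points :: "'a::metric_space set \<Rightarrow> 'a set" where
  "end_points X = {p \<in> X. classical_order X p = 1}"

definition ramification_point :: "'a::metric_space set \<Rightarrow> 'a \<Rightarrow> bool" where
  "ramification_point X p \<longleftrightarrow> p \<in> X \<and> classical_order X p > 2"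

definition fan :: "'a::metric_space set \<Rightarrow> bool" where
  "fan X \<longleftrightarrow> dendroid X \<and> (\<exists>!t. ramification_point X t)"

definition fan_top :: "'a::metric_space set \<Rightarrow> 'a" where
  "fan_top X = (THE t. ramification_point X t)"

text \<open>The Hausdorff metric, for nonempty compact sets.\<close>

definition hausdorff_dist :: "'a::metric_space set \<Rightarrow> 'a set \<Rightarrow> real" where
  "hausdorff_dist A B = max (SUP a\<in>A. infdist a B) (SUP b\<in>B. infdist b A)"

definition smooth_at_wrt :: "'a::metric_space set \<Rightarrow> 'a \<Rightarrow> 'a \<Rightarrow> bool" where
  "smooth_at_wrt X p a \<longleftrightarrow>
     (\<forall>s. range s \<subseteq> X \<and> s \<longlonglongrightarrow> a \<longrightarrow>
        (\<lambda>n. hausdorff_dist (the_arc X p (s n)) (the_arc X p a)) \<longlonglongrightarrow> 0)"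

definition smooth :: "'a::metric_space set \<Rightarrow> bool" where
  "smooth X \<longleftrightarrow> (\<exists>p\<in>X. \<forall>a\<in>X. smooth_at_wrt X p a)"

text \<open>The set \<open>S(X)\<close> for a fan \<open>X\<close>.\<close>

definition smooth_set :: "'a::metric_space set \<Rightarrow> 'a set" where
  "smooth_set X = {a \<in> X. smooth_at_wrt X (fan_top X) a}"

definition same_orbit :: "'a::metric_space set \<Rightarrow> ('a \<times> 'a) set" where
  "same_orbit X = {(x, y). x \<in> X \<and> (\<exists>f g. homeomorphism X X f g \<and> y = f x)}"

text \<open>\<open>1/n\<close>-homogeneity, for \<open>n \<ge> 1\<close>; finiteness is needed because \<open>card\<close> of an infinite set is 0.\<close>

definition fractionally_homogeneous :: "nat \<Rightarrow> 'a::metric_space set \<Rightarrow> bool" where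
  "fractionally_homogeneous n X \<longleftrightarrow>
     finite (X // same_orbit X) \<and> card (X // same_orbit X) = n"

text \<open>Neighborhoods are not required to be open.\<close>

definition colocally_connected_at :: "'a::metric_space set \<Rightarrow> 'a \<Rightarrow> bool" where
  "colocally_connected_at X p \<longleftrightarrow>
     neighbourhood_base_at p (\<lambda>V. connected (X - V)) (top_of_set X)"

end

theory Submission
  imports Defs
begin

text \<open>
  Order \<open>X\<close> by \<open>x \<preceq> y\<close> iff \<open>x\<close> lies on the arc \<open>ty\<close>, and let \<open>\<sqsubseteq>\<close> be the closure of this relation in
  \<open>X \<times> X\<close>. Since \<open>a \<mapsto> ta\<close> is lower semicontinuous, \<open>X\<close> is smooth at \<open>t\<close> with respect to \<open>a\<close> as soon as
  \<open>p \<sqsubseteq> a\<close> implies \<open>p \<preceq> a\<close>, and by Baire's theorem the set of such \<open>a\<close> is dense. A second use of Baire's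
  theorem shows that in a nondegenerate dendroid \<open>p \<sqsubseteq> t\<close> cannot hold for all \<open>p\<close>, as otherwise some arc
  would oscillate infinitely often.

  A homeomorphism maps legs to legs, so with four orbits all ends are equivalent and the inner points
  of the legs form two orbits; hence no inner point of a leg is fixed by the stabilizer of the leg.
  So the closed invariant set of all \<open>c \<preceq> e\<close> with \<open>e \<sqsubseteq> c\<close> has least element \<open>t\<close> or \<open>e\<close>, and \<open>t\<close> is impossible.
  Thus \<open>e \<sqsubseteq> y\<close> only for \<open>y = e\<close>, which is colocal connectedness at \<open>e\<close>; by the same argument \<open>p \<sqsubseteq> t\<close> only
  for \<open>p = t\<close>, and smoothness at the ends follows. If the ends were not dense, their closure would
  consist of ends and possibly \<open>t\<close>, while every leg would be folded onto itself in the limit; a third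
  use of Baire's theorem yields an infinitely oscillating arc again.
\<close>

section \<open>Baire category in compact sets\<close>

text \<open>What makes Baire's theorem yield infinite oscillation is a count. Uniform continuity
  lets one arc pass only finitely often between two sets at positive distance, whereas making at
  least n passages is an open condition on the endpoint, since arcs depend lower semicontinuously on
  their endpoints. So it suffices to raise the count inside every small open set. The obstacle is
  that \<open>\<sqsubseteq>\<close> is not known to be transitive. It composes with
  \<open>\<preceq>\<close> on the left, and a related pair can be moved along the arc joining its
  two points; every argument is arranged to need no more than this. The orbit count is used once
  more at the end: if some inner point of a leg is smooth, then in the nonsmooth case the smooth and
  the nonsmooth inner points form one orbit each. An invariant set such as the closure of the ends
  then contains all or none of either class.\<close>

lemma openin_subset_sequentially:
  fixes Y :: "'a::metric_space set"
  assumes "H \<subseteq> Y"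
    and "\<And>x s. x \<in> H \<Longrightarrow> (\<And>n. s n \<in> Y) \<Longrightarrow> s \<longlonglongrightarrow> x \<Longrightarrow> eventually (\<lambda>n. s n \<in> H) sequentially"
  shows "openin (top_of_set Y) H"
proof -
  have "closure (Y - H) \<inter> H = {}"
  proof (rule ccontr)
    assume "closure (Y - H) \<inter> H \<noteq> {}"
    then obtain x where "x \<in> H" "x \<in> closure (Y - H)" by blast
    then obtain s where s: "x \<in> H" "\<forall>n. s n \<in> Y - H" "s \<longlonglongrightarrow> x"
      unfolding closure_sequential by blast
    then have "eventually (\<lambda>n. s n \<in> H) sequentially"
      using assms(2)[of x s] by blast
    then show False
      using s(2) by (auto simp: eventually_sequentially)
  qed
  then have "H = Y \<inter> - closure (Y - H)"
    using assms(1) closure_subset[of "Y - H"] by blast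
  then show ?thesis
    by (metis closed_closure openin_open_Int open_Compl)
qed

lemma compact_Baire_closed_cover:
  fixes Y :: "'a::metric_space set"
  assumes "compact Y" "Y \<noteq> {}" "countable F" "Y \<subseteq> \<Union>F" "\<And>T. T \<in> F \<Longrightarrow> closed T"
  obtains T W where "T \<in> F" "open W" "W \<inter> Y \<noteq> {}" "W \<inter> Y \<subseteq> T"
proof -
  let ?X = "top_of_set Y"
  have "?X interior_of \<Union>((\<inter>) Y ` F) = {}"
    if none: "\<And>T W. T \<in> F \<Longrightarrow> open W \<Longrightarrow> W \<inter> Y \<subseteq> T \<Longrightarrow> W \<inter> Y = {}"
  proof (rule Baire_category_alt)
    have "compact_space ?X" "Hausdorff_space ?X"
      using assms(1) by (auto simp: compact_space_subtopology Hausdorff_space_subtopology)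
    then show "completely_metrizable_space ?X \<or> locally_compact_space ?X \<and> regular_space ?X"
      using compact_Hausdorff_imp_regular_space compact_imp_locally_compact_space by blast
    show "countable ((\<inter>) Y ` F)" using assms(3) by simp
    fix T assume "T \<in> (\<inter>) Y ` F"
    then obtain T' where T': "T' \<in> F" "T = Y \<inter> T'" by auto
    have "G = {}" if "openin ?X G" "G \<subseteq> T" for G
      using that T' none[of T'] by (auto simp: openin_open)
    then have "?X interior_of T = {}"
      by (metis interior_of_subset openin_interior_of)
    then show "closedin ?X T \<and> ?X interior_of T = {}"
      using T' assms(5) by (auto simp: closedin_closed)
  qed
  moreover have "?X interior_of \<Union>((\<inter>) Y ` F) = Y"
  proof -
    have "\<Union>((\<inter>) Y ` F) = topspace ?X" using assms(4) by auto
    then show ?thesis by (metis interior_of_topspace topspace_euclidean_subtopology)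
  qed
  ultimately show thesis using assms(2) that by metis
qed

text \<open>Density is asked for only inside \<open>W\<close>, because points with many alternations
  are produced only near a chosen point or a chosen set of ends.\<close>

lemma compact_Baire_dense_open:
  fixes Y :: "'a::metric_space set"
  assumes "compact Y" "open W" "W \<inter> Y \<noteq> {}" "countable \<H>"
    and op: "\<And>H. H \<in> \<H> \<Longrightarrow> openin (top_of_set Y) H"
    and dense: "\<And>H G. H \<in> \<H> \<Longrightarrow> open G \<Longrightarrow> G \<subseteq> W \<Longrightarrow> G \<inter> Y \<noteq> {} \<Longrightarrow> G \<inter> H \<noteq> {}"
  obtains x where "x \<in> W" "x \<in> Y" "\<And>H. H \<in> \<H> \<Longrightarrow> x \<in> H"
proof (rule ccontr)
  assume "\<not> thesis"
  then have none: "\<And>x. x \<in> W \<Longrightarrow> x \<in> Y \<Longrightarrow> \<exists>H\<in>\<H>. x \<notin> H"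
    using that by blast
  obtain w where w: "w \<in> W" "w \<in> Y" using assms(3) by auto
  then obtain r where r: "r > 0" "cball w r \<subseteq> W"
    using assms(2) open_contains_cball by blast
  \<comment> \<open>As the closure of a relatively open piece, \<open>Z\<close> is compact and stays
    inside \<open>W\<close>, and every open set meeting \<open>Z\<close> meets
    \<open>ball w r \<inter> Y\<close>, where density applies.\<close>
  define Z where "Z = closure (ball w r \<inter> Y)"
  have ZY: "Z \<subseteq> Y"
    unfolding Z_def using assms(1) by (simp add: closure_minimal compact_imp_closed)
  have ZW: "Z \<subseteq> W"
    using r closure_mono[of "ball w r \<inter> Y" "cball w r"] unfolding Z_def
    by (metis Int_lower1 ball_subset_cball closed_cball closure_minimal order_trans)
  have cl: "closed (Y - H)" if H: "H \<in> \<H>" for H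
    using op[OF H] assms(1)
    by (metis closedin_closed_trans closedin_diff closedin_subtopology_refl compact_imp_closed
        closedin_topspace topspace_euclidean_subtopology)
  have "compact Z"
    by (metis Z_def ZY assms(1) closed_closure compact_Int_closed inf.absorb_iff2)
  moreover have "Z \<noteq> {}"
    using w r closure_subset[of "ball w r \<inter> Y"] unfolding Z_def by force
  moreover have "countable ((-) Y ` \<H>)" using assms(4) by simp
  moreover have "Z \<subseteq> \<Union>((-) Y ` \<H>)"
    using none ZY ZW by blast
  ultimately obtain T V where T: "T \<in> (-) Y ` \<H>" "open V" "V \<inter> Z \<noteq> {}" "V \<inter> Z \<subseteq> T"
    using compact_Baire_closed_cover[of Z "(-) Y ` \<H>"] cl by blast
  then obtain H where H: "H \<in> \<H>" "T = Y - H" by auto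
  have "V \<inter> (ball w r \<inter> Y) \<noteq> {}"
    using T(2,3) unfolding Z_def by (simp add: open_Int_closure_eq_empty)
  then have "(V \<inter> ball w r) \<inter> H \<noteq> {}"
    using dense[OF H(1), of "V \<inter> ball w r"] T(2) r ball_subset_cball[of w r] by (force simp: Int_assoc)
  then obtain h where h: "h \<in> V" "h \<in> ball w r" "h \<in> H" by blast
  have "h \<in> Y" using op[OF H(1)] h(3) openin_imp_subset by blast
  then have "h \<in> Z" using h closure_subset[of "ball w r \<inter> Y"] unfolding Z_def by blast
  then show False using T(4) h H(2) by blast
qed

lemma compact_countable_dense_subset:
  fixes Y :: "'a::metric_space set"
  assumes "compact Y"
  obtains D where "countable D" "\<And>y r. y \<in> Y \<Longrightarrow> r > 0 \<Longrightarrow> \<exists>d\<in>D. dist d y < r"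
proof -
  have "\<exists>k. finite k \<and> Y \<subseteq> (\<Union>x\<in>k. ball x (inverse (real (Suc n))))" for n
    using seq_compact_imp_totally_bounded[OF compact_imp_seq_compact[OF assms]]
    by (meson inverse_positive_iff_positive of_nat_0_less_iff zero_less_Suc)
  then obtain k where k: "\<And>n. finite (k n)" "\<And>n. Y \<subseteq> (\<Union>x\<in>k n. ball x (inverse (real (Suc n))))"
    by metis
  show thesis
  proof
    show "countable (\<Union>n. k n)" using k(1) by (simp add: countable_finite)
    fix y r assume "y \<in> Y" "r > (0::real)"
    then obtain n where "inverse (real (Suc n)) < r" using reals_Archimedean by blast
    moreover obtain x where "x \<in> k n" "dist x y < inverse (real (Suc n))"
      using k(2) \<open>y \<in> Y\<close> by fastforce
    ultimately show "\<exists>d\<in>\<Union>n. k n. dist d y < r" by (meson UNIV_I UN_I less_trans)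
  qed
qed

section \<open>Arcs in dendroids as least continua\<close>

lemma continuum_Un:
  assumes "continuum K" "continuum L" "K \<inter> L \<noteq> {}"
  shows "continuum (K \<union> L)"
  using assms by (auto simp: continuum_def connected_Un compact_Un)

text \<open>Unicoherence of the continuum \<open>K \<union> L\<close>, applied to its two closed
  connected pieces. The later facts on arcs in dendroids rest on this.\<close>

lemma dendroid_continuum_Int:
  assumes "dendroid X" "continuum K" "K \<subseteq> X" "continuum L" "L \<subseteq> X" "K \<inter> L \<noteq> {}"
  shows "continuum (K \<inter> L)"
proof -
  have "continuum (K \<union> L)" using assms continuum_Un by blast
  then have "unicoherent (K \<union> L)"
    using assms by (auto simp: dendroid_def hereditarily_unicoherent_def)
  moreover have "closedin (top_of_set (K \<union> L)) K" "closedin (top_of_set (K \<union> L)) L"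
    using assms by (auto simp: continuum_def compact_imp_closed closed_subset)
  moreover have "connected K" "connected L" using assms by (auto simp: continuum_def)
  ultimately have "connected (K \<inter> L)"
    unfolding unicoherent_def by metis
  then show ?thesis using assms by (auto simp: continuum_def compact_Int)
qed

lemma arc_joining_continuum:
  assumes "arc_joining X p q A"
  shows "continuum A" "A \<subseteq> X" "p \<in> A" "q \<in> A"
proof -
  obtain g where g: "arc g" "pathstart g = p" "pathfinish g = q" "path_image g = A" "A \<subseteq> X"
    using assms unfolding arc_joining_def by metis
  show "continuum A" "A \<subseteq> X" "p \<in> A" "q \<in> A"
    using g compact_path_image[OF arc_imp_path[OF g(1)]] connected_path_image[OF arc_imp_path[OF g(1)]]
      pathstart_in_path_image[of g] pathfinish_in_path_image[of g]
    unfolding continuum_def by (auto simp only: path_image_nonempty)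
qed

lemma connected_subset_arc:
  fixes g :: "real \<Rightarrow> 'a::metric_space"
  assumes "arc g" "connected K" "K \<subseteq> path_image g" "pathstart g \<in> K" "pathfinish g \<in> K"
  shows "K = path_image g"
proof -
  obtain h where h: "homeomorphism {0..1} (path_image g) g h"
    using homeomorphism_arc[OF assms(1)] by metis
  have "connected (h ` K)"
    using assms(2,3) h by (meson connected_continuous_image continuous_on_subset homeomorphism_def)
  moreover have "0 \<in> h ` K" "1 \<in> h ` K"
    using assms(4,5) h by (force simp: homeomorphism_def pathstart_def pathfinish_def image_iff)+
  ultimately have "{0..1} \<subseteq> h ` K"
    using connected_contains_Icc by blast
  then have "path_image g \<subseteq> K"
    using h assms(3) unfolding homeomorphism_def path_image_def by force
  then show ?thesis using assms(3) by blast
qed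

text \<open>\<open>A \<inter> K\<close> is a connected part of the arc containing both its
  endpoints, hence all of it. Minimality gives uniqueness of arcs and later replaces most work with
  parametrizations.\<close>

lemma arc_joining_minimal:
  assumes "dendroid X" "arc_joining X p q A" "continuum K" "K \<subseteq> X" "p \<in> K" "q \<in> K"
  shows "A \<subseteq> K"
proof -
  obtain g where g: "arc g" "pathstart g = p" "pathfinish g = q" "path_image g = A"
    using assms(2) by (auto simp: arc_joining_def)
  have "continuum (A \<inter> K)"
    using dendroid_continuum_Int[OF assms(1)] arc_joining_continuum[OF assms(2)] assms by blast
  then have "A \<inter> K = A"
    using connected_subset_arc[OF g(1), of "A \<inter> K"] g assms(5,6) arc_joining_continuum[OF assms(2)]
    by (auto simp: continuum_def)
  then show ?thesis by blast
qed

lemma the_arc_eq: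
  assumes "dendroid X" "p \<noteq> q" "arc_joining X p q A"
  shows "the_arc X p q = A"
proof -
  have "B = A" if "arc_joining X p q B" for B
    using arc_joining_minimal[OF assms(1) that arc_joining_continuum[OF assms(3)]]
      arc_joining_minimal[OF assms(1,3) arc_joining_continuum[OF that]] by blast
  then have "(THE B. arc_joining X p q B) = A"
    using assms(3) by (intro the_equality)
  then show ?thesis using assms(2) by (simp add: the_arc_def)
qed

lemma the_arc_joining:
  assumes "dendroid X" "p \<in> X" "q \<in> X" "p \<noteq> q"
  shows "arc_joining X p q (the_arc X p q)"
proof -
  obtain A where A: "arc_joining X p q A"
    using assms unfolding arcwise_connected_def dendroid_def by blast
  show ?thesis using the_arc_eq[OF assms(1,4) A] A by simp
qed

text \<open>Allows results on pointed dendroids to be applied to the closure of a piece of a leg,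
  with arcs keeping their meaning.\<close>

lemma subdendroid:
  assumes "dendroid X" "continuum Y" "Y \<subseteq> X"
  shows "dendroid Y" "\<And>p q. p \<in> Y \<Longrightarrow> q \<in> Y \<Longrightarrow> the_arc Y p q = the_arc X p q"
proof -
  have j: "arc_joining Y p q (the_arc X p q)" if pq: "p \<in> Y" "q \<in> Y" "p \<noteq> q" for p q
  proof -
    have 1: "arc_joining X p q (the_arc X p q)"
      using pq assms(3) by (intro the_arc_joining[OF assms(1)]) auto
    then have "the_arc X p q \<subseteq> Y"
      using arc_joining_minimal[OF assms(1) 1 assms(2,3)] pq by blast
    then show ?thesis using 1 unfolding arc_joining_def by blast
  qed
  have "hereditarily_unicoherent Y"
    using assms(1,3) unfolding dendroid_def hereditarily_unicoherent_def by (meson order_trans)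
  moreover have "arcwise_connected Y"
    using j unfolding arcwise_connected_def by blast
  ultimately show d: "dendroid Y"
    using assms(2) unfolding dendroid_def by blast
  show "the_arc Y p q = the_arc X p q" if "p \<in> Y" "q \<in> Y" for p q
  proof (cases "p = q")
    case False then show ?thesis using the_arc_eq[OF d False j] that by simp
  qed (simp add: the_arc_def)
qed

text \<open>The base point is left arbitrary: besides the fan with its top, the closure of a piece
  of a leg with another base point will be an instance.\<close>

locale pointed_dendroid =
  fixes X :: "'a::metric_space set" and t :: 'a
  assumes dendroid: "dendroid X" and base: "t \<in> X"
begin

abbreviation seg :: "'a \<Rightarrow> 'a \<Rightarrow> 'a set" where "seg \<equiv> the_arc X"

text \<open>The conjunct \<open>y \<in> X\<close> is a guard, because \<open>the_arc\<close> is
  unspecified where no arc exists. With it the relation implies that both points lie in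
  \<open>X\<close>.\<close>

definition below :: "'a \<Rightarrow> 'a \<Rightarrow> bool" (infix "\<preceq>" 50) where
  "x \<preceq> y \<longleftrightarrow> y \<in> X \<and> x \<in> seg t y"

lemma continuum_X: "continuum X" using dendroid by (simp add: dendroid_def)
lemma compact_X: "compact X" and connected_X: "connected X"
  using continuum_X by (auto simp: continuum_def)

lemma seg_self [simp]: "seg p p = {p}" by (simp add: the_arc_def)

lemma seg_joining: "p \<in> X \<Longrightarrow> q \<in> X \<Longrightarrow> p \<noteq> q \<Longrightarrow> arc_joining X p q (seg p q)"
  by (rule the_arc_joining[OF dendroid])

lemma seg_continuum: "continuum (seg p q)"
  and seg_subset: "seg p q \<subseteq> X"
  and seg_ends: "p \<in> seg p q" "q \<in> seg p q"
  if "p \<in> X" "q \<in> X"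
proof -
  have "continuum (seg p q) \<and> seg p q \<subseteq> X \<and> p \<in> seg p q \<and> q \<in> seg p q"
  proof (cases "p = q")
    case True then show ?thesis using that by (simp add: continuum_def)
  next
    case False then show ?thesis using arc_joining_continuum[OF seg_joining] that by simp
  qed
  then show "continuum (seg p q)" "seg p q \<subseteq> X" "p \<in> seg p q" "q \<in> seg p q" by auto
qed

lemma seg_compact: "p \<in> X \<Longrightarrow> q \<in> X \<Longrightarrow> compact (seg p q)"
  and seg_connected: "p \<in> X \<Longrightarrow> q \<in> X \<Longrightarrow> connected (seg p q)"
  and seg_closed: "p \<in> X \<Longrightarrow> q \<in> X \<Longrightarrow> closed (seg p q)"
  using seg_continuum[of p q] by (auto simp: continuum_def compact_imp_closed)

lemma seg_minimal:
  assumes "continuum K" "K \<subseteq> X" "p \<in> K" "q \<in> K"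
  shows "seg p q \<subseteq> K"
proof (cases "p = q")
  case False
  then show ?thesis
    using arc_joining_minimal[OF dendroid seg_joining[OF _ _ False] assms] assms by blast
qed (use assms in simp)

lemma seg_sym: "p \<in> X \<Longrightarrow> q \<in> X \<Longrightarrow> seg p q = seg q p"
  by (intro equalityI seg_minimal seg_continuum seg_subset seg_ends)

lemma seg_mono: "p \<in> X \<Longrightarrow> q \<in> X \<Longrightarrow> a \<in> seg p q \<Longrightarrow> b \<in> seg p q \<Longrightarrow> seg a b \<subseteq> seg p q"
  by (intro seg_minimal seg_continuum seg_subset)

lemma seg_param:
  assumes "p \<in> X" "q \<in> X" "p \<noteq> q"
  obtains g :: "real \<Rightarrow> 'a" where "continuous_on {0..1} g" "inj_on g {0..1}" "g 0 = p" "g 1 = q"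
    "seg p q = g ` {0..1}"
    "\<And>s. s \<in> {0..1} \<Longrightarrow> seg p (g s) = g ` {0..s}"
    "\<And>s. s \<in> {0..1} \<Longrightarrow> seg (g s) q = g ` {s..1}"
proof -
  obtain g where g: "arc g" "pathstart g = p" "pathfinish g = q" "path_image g = seg p q"
    using the_arc_joining[OF dendroid assms] by (auto simp: arc_joining_def)
  have c: "continuous_on {0..1} g" and i: "inj_on g {0..1}" and e: "g 0 = p" "g 1 = q"
    and im: "seg p q = g ` {0..1}"
    using g by (auto simp: arc_def path_def pathstart_def pathfinish_def path_image_def)
  have sub: "continuum (g ` {a..b})" "g ` {a..b} \<subseteq> X" if "0 \<le> a" "a \<le> b" "b \<le> 1" for a b
  proof -
    have "continuous_on {a..b} g" using c that by (auto intro: continuous_on_subset)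
    then show "continuum (g ` {a..b})"
      using that by (auto simp: continuum_def compact_continuous_image connected_continuous_image)
    have "g ` {a..b} \<subseteq> g ` {0..1}" using that by (intro image_mono) auto
    then show "g ` {a..b} \<subseteq> X" using im seg_subset[OF assms(1,2)] by blast
  qed
  have main: "seg p (g s) = g ` {0..s}" "seg (g s) q = g ` {s..1}" if s: "s \<in> {0..1}" for s
  proof -
    have s': "0 \<le> s" "s \<le> 1" using s by auto
    have X: "g s \<in> X" using sub(2)[of s s] s' by auto
    have 1: "seg p (g s) \<subseteq> g ` {0..s}"
      using s' by (intro seg_minimal sub) (auto simp flip: e)
    have 2: "seg (g s) q \<subseteq> g ` {s..1}"
      using s' by (intro seg_minimal sub) (auto simp flip: e)
    \<comment> \<open>The two smaller arcs cover the whole one. By injectivity of \<open>g\<close> a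
      parameter below \<open>s\<close> cannot belong to the second, nor one above \<open>s\<close>
      to the first, so the inclusions from minimality become equalities.\<close>
    have "seg p q \<subseteq> seg p (g s) \<union> seg (g s) q"
      using assms X by (intro seg_minimal continuum_Un seg_continuum Un_least seg_subset)
        (auto intro: seg_ends dest: seg_ends)
    then have 3: "g ` {0..1} \<subseteq> seg p (g s) \<union> seg (g s) q" using im by simp
    have 4: "u \<le> s" if h: "u \<in> {0..1}" "g u \<in> seg p (g s)" for u
    proof -
      obtain v where v: "v \<in> {0..s}" "g u = g v" using 1 h(2) by blast
      then have "u = v" using h(1) s' by (intro inj_onD[OF i]) auto
      then show ?thesis using v by simp
    qed
    have 5: "s \<le> u" if h: "u \<in> {0..1}" "g u \<in> seg (g s) q" for u
    proof -
      obtain v where v: "v \<in> {s..1}" "g u = g v" using 2 h(2) by blast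
      then have "u = v" using h(1) s' by (intro inj_onD[OF i]) auto
      then show ?thesis using v by simp
    qed
    have "g u \<in> seg p (g s)" if "u \<in> {0..s}" for u
    proof (cases "u = s")
      case True then show ?thesis using seg_ends(2)[OF assms(1) X] by simp
    next
      case False
      have u: "u \<in> {0..1}" using that s' by auto
      then have "g u \<notin> seg (g s) q" using 5[of u] that False by auto
      then show ?thesis using 3 u by blast
    qed
    then show "seg p (g s) = g ` {0..s}" using 1 by blast
    have "g u \<in> seg (g s) q" if "u \<in> {s..1}" for u
    proof (cases "u = s")
      case True then show ?thesis using seg_ends(1)[OF X assms(2)] by simp
    next
      case False
      have u: "u \<in> {0..1}" using that s' by auto
      then have "g u \<notin> seg p (g s)" using 4[of u] that False by auto
      then show ?thesis using 3 u by blast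
    qed
    then show "seg (g s) q = g ` {s..1}" using 2 by blast
  qed
  then show thesis using that c i e im by blast
qed

lemma seg_Int:
  assumes "p \<in> X" "q \<in> X" "c \<in> seg p q"
  shows "seg p c \<inter> seg c q = {c}"
proof (cases "p = q")
  case False
  then obtain g where g: "inj_on g {0..1::real}" "seg p q = g ` {0..1}"
    "\<And>s. s \<in> {0..1} \<Longrightarrow> seg p (g s) = g ` {0..s}"
    "\<And>s. s \<in> {0..1} \<Longrightarrow> seg (g s) q = g ` {s..1}"
    using seg_param[OF assms(1,2)] by metis
  obtain s where s: "s \<in> {0..1}" "c = g s" using assms(3) g(2) by auto
  have "g ` {0..s} \<inter> g ` {s..1} = g ` ({0..s} \<inter> {s..1})"
    using s(1) by (intro inj_on_image_Int[OF g(1), symmetric]) auto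
  also have "{0..s} \<inter> {s..1} = {s}" using s(1) by auto
  finally show ?thesis using s g(3,4) by simp
qed (use assms in auto)

lemma seg_Un:
  assumes "p \<in> X" "q \<in> X" "c \<in> seg p q"
  shows "seg p c \<union> seg c q = seg p q"
proof
  have cX: "c \<in> X" using assms seg_subset by blast
  show "seg p c \<union> seg c q \<subseteq> seg p q"
    using assms seg_mono seg_ends by (meson Un_least)
  show "seg p q \<subseteq> seg p c \<union> seg c q"
    using assms cX by (intro seg_minimal continuum_Un seg_continuum Un_least seg_subset)
        (auto intro: seg_ends dest: seg_ends)
qed

lemma closed_subset_seg_max:
  assumes "p \<in> X" "q \<in> X" "C \<subseteq> seg p q" "closed C" "C \<noteq> {}"
  obtains m where "m \<in> C" "C \<subseteq> seg p m"
proof (cases "p = q")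
  case True
  then have "C = {p}" using assms by auto
  then show thesis using that by auto
next
  case False
  then obtain g where g: "continuous_on {0..1::real} g" "inj_on g {0..1}" "seg p q = g ` {0..1}"
    "\<And>s. s \<in> {0..1} \<Longrightarrow> seg p (g s) = g ` {0..s}"
    using seg_param[OF assms(1,2)] by metis
  define D where "D = {0..1} \<inter> g -` C"
  have "closed D" unfolding D_def
    using assms(4) g(1) continuous_closed_preimage by blast
  then have "compact D" unfolding D_def
    by (metis bounded_Int bounded_closed_interval compact_eq_bounded_closed)
  moreover have "D \<noteq> {}" using assms(3,5) g(3) unfolding D_def by force
  ultimately obtain s where s: "s \<in> D" "\<And>u. u \<in> D \<Longrightarrow> u \<le> s"
    using compact_attains_sup[of D] by metis
  have "C \<subseteq> seg p (g s)"
  proof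
    fix c assume c: "c \<in> C"
    then obtain u where u: "u \<in> {0..1}" "c = g u" using assms(3) g(3) by auto
    then have "u \<le> s" using s c by (auto simp: D_def)
    then show "c \<in> seg p (g s)" using g(4)[of s] s(1) u by (auto simp: D_def)
  qed
  then show thesis using that s(1) by (auto simp: D_def)
qed

text \<open>Otherwise the endpoints would lie in different components of the complement of \<open>G\<close>, and a
  separation of that compact set would also separate the ends of the nearby arcs.\<close>

lemma seg_lower_semicontinuous:
  assumes "p \<in> X" "q \<in> X" "c \<in> seg p q" "open G" "c \<in> G"
    and "\<And>n. P n \<in> X" "\<And>n. Q n \<in> X" "P \<longlonglongrightarrow> p" "Q \<longlonglongrightarrow> q"
  shows "eventually (\<lambda>n. seg (P n) (Q n) \<inter> G \<noteq> {}) sequentially"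
proof (rule ccontr)
  assume neg: "\<not> ?thesis"
  then have fr: "frequently (\<lambda>n. seg (P n) (Q n) \<inter> G = {}) sequentially"
    by (simp add: not_eventually)
  let ?K = "X - G"
  have K: "compact ?K" using compact_X assms(4) by (simp add: compact_diff)
  have pq: "p \<in> ?K \<and> q \<in> ?K"
  proof -
    have "closed (-G)" using assms(4) by auto
    obtain r :: "nat \<Rightarrow> nat" where r: "strict_mono r" "\<And>n. seg (P (r n)) (Q (r n)) \<inter> G = {}"
      using not_eventually_sequentiallyD[OF neg] by (metis (no_types, lifting))
    have "(P \<circ> r) \<longlonglongrightarrow> p" "(Q \<circ> r) \<longlonglongrightarrow> q"
      using LIMSEQ_subseq_LIMSEQ r(1) assms(8,9) by auto
    moreover have "(P \<circ> r) n \<in> -G" "(Q \<circ> r) n \<in> -G" for n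
      using r(2)[of n] seg_ends[of "P (r n)" "Q (r n)"] assms(6,7) by auto
    ultimately have "p \<in> -G" "q \<in> -G"
      using \<open>closed (-G)\<close> unfolding closed_sequential_limits by blast+
    then show ?thesis using assms(1,2) by auto
  qed
  let ?T = "top_of_set ?K"
  have "\<not> connected_component_of ?T p q"
  proof
    assume cc: "connected_component_of ?T p q"
    let ?C = "connected_component_of_set ?T p"
    have "closedin ?T ?C" by (simp add: closedin_connected_component_of)
    then have "compact ?C" using K closedin_compact by blast
    moreover have "connected ?C"
      using connectedin_connected_component_of[of ?T p] by (simp add: connectedin_subtopology)
    moreover have "?C \<subseteq> ?K"
      using connected_component_of_subset_topspace[of ?T p] by auto
    ultimately have "seg p q \<subseteq> ?C"
      using cc pq by (intro seg_minimal) (auto simp: continuum_def connected_component_of_refl)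
    then show False using \<open>?C \<subseteq> ?K\<close> assms(3,5) by blast
  qed
  \<comment> \<open>In a compact Hausdorff space components and quasi-components coincide; this
    turns the failure of connectedness into a clopen set between \<open>p\<close> and
    \<open>q\<close>.\<close>
  moreover have "quasi_component_of ?T p = connected_component_of ?T p"
    using K by (intro quasi_eq_connected_component_of)
      (auto simp: compact_space_subtopology compact_imp_locally_compact_space Hausdorff_space_subtopology)
  ultimately have "\<not> quasi_component_of ?T p q" by metis
  then obtain T where T: "closedin ?T T" "openin ?T T" "(p \<in> T) \<noteq> (q \<in> T)"
    using pq by (auto simp: quasi_component_of_def)
  have key: False if T: "closedin ?T T" "openin ?T T" "p \<in> T" "q \<notin> T" for T
  proof -
    obtain V where V: "open V" "T = ?K \<inter> V" using T(2) by (auto simp: openin_open)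
    have "openin ?T (?K - T)" using T(1) by (metis openin_diff openin_topspace topspace_euclidean_subtopology)
    then obtain V' where V': "open V'" "?K - T = ?K \<inter> V'" by (auto simp: openin_open)
    have "eventually (\<lambda>n. P n \<in> V) sequentially"
      using assms(8) V T(3) by (auto intro: topological_tendstoD)
    moreover have "eventually (\<lambda>n. Q n \<in> V') sequentially"
      using assms(9) V' T(4) pq by (auto intro: topological_tendstoD)
    ultimately have "eventually (\<lambda>n. P n \<in> V \<and> Q n \<in> V') sequentially"
      by (rule eventually_conj)
    then obtain n where n: "seg (P n) (Q n) \<inter> G = {}" "P n \<in> V" "Q n \<in> V'"
      using frequently_ex[OF frequently_eventually_conj[OF fr]] by blast
    let ?S = "seg (P n) (Q n)"
    have S: "?S \<subseteq> ?K" "P n \<in> ?S" "Q n \<in> ?S" "connected ?S"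
      using n(1) seg_subset[OF assms(6,7)] seg_ends[OF assms(6,7)] seg_connected[OF assms(6,7)] by blast+
    then have "?S \<subseteq> V \<union> V'" "V \<inter> V' \<inter> ?S = {}" using V V' by blast+
    then show False using connectedD[OF S(4) V(1) V'(1)] S(2,3) n by blast
  qed
  show False
  proof (cases "p \<in> T")
    case True then show ?thesis using T key by blast
  next
    case False
    have "closedin ?T (?K - T)" "openin ?T (?K - T)"
      using T by (metis closedin_diff closedin_topspace openin_diff openin_topspace topspace_euclidean_subtopology)+
    then show ?thesis using False T(3) pq key by blast
  qed
qed

lemma seg_limit:
  assumes "p \<in> X" "q \<in> X" "c \<in> seg p q"
    and PQ: "\<And>n. P n \<in> X" "\<And>n. Q n \<in> X" "P \<longlonglongrightarrow> p" "Q \<longlonglongrightarrow> q"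
  obtains C where "\<And>n. C n \<in> seg (P n) (Q n)" "C \<longlonglongrightarrow> c"
proof -
  \<comment> \<open>\<open>C n\<close> will be a point of the n-th arc nearest to
    \<open>c\<close>.\<close>
  have "\<exists>x\<in>seg (P n) (Q n). \<forall>y\<in>seg (P n) (Q n). dist c x \<le> dist c y" for n
  proof (intro continuous_attains_inf seg_compact PQ)
    show "seg (P n) (Q n) \<noteq> {}" using seg_ends(1)[of "P n" "Q n"] PQ(1,2) by blast
  qed (intro continuous_intros)
  then obtain C where C: "\<And>n. C n \<in> seg (P n) (Q n)" "\<And>n y. y \<in> seg (P n) (Q n) \<Longrightarrow> dist c (C n) \<le> dist c y"
    by metis
  have "C \<longlonglongrightarrow> c"
  proof (rule metric_LIMSEQ_I)
    fix r :: real assume "r > 0"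
    then have "eventually (\<lambda>n. seg (P n) (Q n) \<inter> ball c r \<noteq> {}) sequentially"
      using assms by (intro seg_lower_semicontinuous[of p q c]) auto
    then obtain N where N: "\<And>n. n \<ge> N \<Longrightarrow> seg (P n) (Q n) \<inter> ball c r \<noteq> {}"
      by (auto simp: eventually_sequentially)
    have "dist (C n) c < r" if n: "n \<ge> N" for n
    proof -
      obtain y where "y \<in> seg (P n) (Q n)" "dist c y < r" using N[OF n] by auto
      then show ?thesis using C(2) by (metis dist_commute order_le_less_trans)
    qed
    then show "\<exists>N. \<forall>n\<ge>N. dist (C n) c < r" by blast
  qed
  then show thesis using that C(1) by blast
qed


section \<open>The order from a base point and its closure\<close>

lemma below_X: "x \<in> X" "y \<in> X" if "x \<preceq> y"
  using that seg_subset[OF base] by (auto simp: below_def)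

lemma below_refl: "x \<in> X \<Longrightarrow> x \<preceq> x"
  using seg_ends(2)[OF base] by (simp add: below_def)

lemma base_below: "x \<in> X \<Longrightarrow> t \<preceq> x"
  using seg_ends(1)[OF base] by (simp add: below_def)

lemma below_trans: "x \<preceq> y \<Longrightarrow> y \<preceq> z \<Longrightarrow> x \<preceq> z"
  using seg_mono[OF base, of z t y] seg_ends(1)[OF base, of z] unfolding below_def by blast

lemma below_antisym:
  assumes "x \<preceq> y" "y \<preceq> x"
  shows "x = y"
proof -
  have X: "x \<in> X" "y \<in> X" using assms(1) below_X by auto
  have "seg t x \<inter> seg x y = {x}" using seg_Int[OF base X(2), of x] assms(1) by (simp add: below_def)
  moreover have "y \<in> seg x y" using seg_ends(2)[OF X] .
  moreover have "y \<in> seg t x" using assms(2) by (simp add: below_def)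
  ultimately have "y \<in> {x}" by blast
  then show ?thesis by simp
qed

lemma below_linear:
  assumes "x \<preceq> z" "y \<preceq> z"
  shows "x \<preceq> y \<or> y \<preceq> x"
proof -
  have X: "x \<in> X" "y \<in> X" "z \<in> X" using assms below_X by auto
  have s: "x \<in> seg t z" "y \<in> seg t z" using assms by (auto simp: below_def)
  have 1: "x \<in> seg t y \<or> x \<in> seg y z" using seg_Un[OF base X(3) s(2)] s(1) by blast
  have 2: "y \<in> seg t x \<or> y \<in> seg x z" using seg_Un[OF base X(3) s(1)] s(2) by blast
  have "x = y" if h: "x \<in> seg y z" "y \<in> seg x z"
  proof -
    have "y \<in> {x}" using seg_Int[OF X(2,3) h(1)] h(2) seg_ends(1)[OF X(2,1)] by blast
    then show ?thesis by simp
  qed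
  then show ?thesis using 1 2 X below_refl unfolding below_def by blast
qed

text \<open>The arc from \<open>t\<close> to \<open>y\<close> splits at \<open>p\<close> into two
  arcs with only \<open>p\<close> in common. This is the dictionary between arcs and order
  intervals.\<close>

lemma mem_seg_iff_between:
  assumes "p \<preceq> y"
  shows "c \<in> seg p y \<longleftrightarrow> p \<preceq> c \<and> c \<preceq> y"
proof -
  have X: "p \<in> X" "y \<in> X" using assms below_X by auto
  have py: "p \<in> seg t y" using assms by (simp add: below_def)
  have I: "seg t p \<inter> seg p y = {p}" and U: "seg t p \<union> seg p y = seg t y"
    using seg_Int[OF base X(2) py] seg_Un[OF base X(2) py] by auto
  show ?thesis
  proof
    assume c: "c \<in> seg p y"
    then have cy: "c \<preceq> y" using U X(2) by (auto simp: below_def)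
    moreover have "p \<preceq> c"
    proof (cases "c \<preceq> p")
      case True
      then have "c = p" using I c by (auto simp: below_def)
      then show ?thesis using X(1) below_refl by simp
    next
      case False
      then show ?thesis using below_linear[OF cy assms] by simp
    qed
    ultimately show "p \<preceq> c \<and> c \<preceq> y" by simp
  next
    assume c: "p \<preceq> c \<and> c \<preceq> y"
    then have "c \<in> seg t p \<or> c \<in> seg p y" using U by (auto simp: below_def)
    moreover have "c \<in> seg p y" if "c \<in> seg t p"
    proof -
      have "c \<preceq> p" using that X(1) by (simp add: below_def)
      then have "c = p" using c below_antisym by blast
      then show ?thesis using seg_ends(1)[OF X] by simp
    qed
    ultimately show "c \<in> seg p y" by blast
  qed
qed

lemma inner_point:
  assumes "a \<preceq> b" "a \<noteq> b"
  obtains c where "a \<preceq> c" "c \<preceq> b" "c \<noteq> a" "c \<noteq> b"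
proof -
  obtain g :: "real \<Rightarrow> 'a" where g: "inj_on g {0..1}" "g 0 = a" "g 1 = b" "seg a b = g ` {0..1}"
    by (rule seg_param[OF below_X[OF assms(1)] assms(2)])
  have "g (1/2) \<in> seg a b" using g(4) by auto
  moreover have "g (1/2) \<noteq> g 0" "g (1/2) \<noteq> g 1"
    using inj_on_eq_iff[OF g(1), of "1/2" 0] inj_on_eq_iff[OF g(1), of "1/2" 1] by auto
  ultimately show thesis
    using that[of "g (1/2)"] mem_seg_iff_between[OF assms(1)] g(2,3) by auto
qed

lemma closed_below: "y \<in> X \<Longrightarrow> closed {x. x \<preceq> y}"
  using seg_closed[OF base, of y] by (simp add: below_def)

lemma subseq_X:
  assumes "\<And>n::nat. s n \<in> X"
  obtains l r where "l \<in> X" "strict_mono (r::nat \<Rightarrow> nat)" "(s \<circ> r) \<longlonglongrightarrow> l"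
  using seq_compactE[OF compact_imp_seq_compact[OF compact_X]] assms by blast

lemma limit_X: "(\<And>n. s n \<in> X) \<Longrightarrow> s \<longlonglongrightarrow> l \<Longrightarrow> l \<in> X"
  using closed_sequentially[OF compact_imp_closed[OF compact_X]] by blast

text \<open>For fixed \<open>y\<close>, these \<open>p\<close> form the upper limit of the arcs from
  \<open>t\<close> to points converging to \<open>y\<close>. Passing to the closure does not
  automatically preserve transitivity.\<close>

definition limit_below :: "'a \<Rightarrow> 'a \<Rightarrow> bool" (infix "\<sqsubseteq>" 50) where
  "p \<sqsubseteq> y \<longleftrightarrow> (p, y) \<in> closure {(p, y). p \<preceq> y}"

lemma limit_belowE:
  assumes "p \<sqsubseteq> y"
  obtains P Y where "\<And>n. P n \<preceq> Y n" "P \<longlonglongrightarrow> p" "Y \<longlonglongrightarrow> y"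
proof -
  obtain s where s: "\<forall>n. s n \<in> {(p, y). p \<preceq> y}" "s \<longlonglongrightarrow> (p, y)"
    using assms unfolding limit_below_def closure_sequential by blast
  show thesis
  proof
    show "fst (s n) \<preceq> snd (s n)" for n using s(1) by (auto simp: case_prod_beta)
    show "(\<lambda>n. fst (s n)) \<longlonglongrightarrow> p" "(\<lambda>n. snd (s n)) \<longlonglongrightarrow> y"
      using tendsto_fst[OF s(2)] tendsto_snd[OF s(2)] by simp_all
  qed
qed

lemma limit_below_closed:
  assumes "\<And>n. P n \<sqsubseteq> Y n" "P \<longlonglongrightarrow> p" "Y \<longlonglongrightarrow> y"
  shows "p \<sqsubseteq> y"
  using closed_sequentially[OF closed_closure _ tendsto_Pair[OF assms(2,3)]] assms(1)
  unfolding limit_below_def by blast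

lemma closed_limit_below: "closed {p. p \<sqsubseteq> y}" "closed {y. p \<sqsubseteq> y}"
proof -
  show "closed {p. p \<sqsubseteq> y}"
    unfolding closed_sequential_limits using limit_below_closed[where Y = "\<lambda>n. y"] by auto
  show "closed {y. p \<sqsubseteq> y}"
    unfolding closed_sequential_limits using limit_below_closed[where P = "\<lambda>n. p"] by auto
qed

lemma below_imp_limit_below: "p \<preceq> y \<Longrightarrow> p \<sqsubseteq> y"
  using closure_subset unfolding limit_below_def by fastforce

lemma limit_belowI:
  assumes "\<And>n. P n \<preceq> Y n" "P \<longlonglongrightarrow> p" "Y \<longlonglongrightarrow> y"
  shows "p \<sqsubseteq> y"
  using limit_below_closed[OF below_imp_limit_below[OF assms(1)] assms(2,3)] .

lemma limit_below_X: "p \<in> X" "y \<in> X" if h: "p \<sqsubseteq> y"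
proof -
  obtain P Y where PY: "\<And>n. P n \<preceq> Y n" "P \<longlonglongrightarrow> p" "Y \<longlonglongrightarrow> y"
    using limit_belowE[OF h] by metis
  show "p \<in> X" by (rule limit_X[OF below_X(1)[OF PY(1)] PY(2)])
  show "y \<in> X" by (rule limit_X[OF below_X(2)[OF PY(1)] PY(3)])
qed

text \<open>By lower semicontinuity \<open>c\<close> is a limit of points on the arcs from
  \<open>P n\<close> to \<open>Y n\<close>, which are order intervals. Nothing is said about the
  order of \<open>p\<close> and \<open>y\<close> themselves: \<open>p\<close> may lie strictly above
  \<open>y\<close>, and that case will describe a fold.\<close>

lemma limit_below_seg: "p \<sqsubseteq> c" "c \<sqsubseteq> y" if h: "p \<sqsubseteq> y" "c \<in> seg p y"
proof -
  obtain P Y where PY: "\<And>n. P n \<preceq> Y n" "P \<longlonglongrightarrow> p" "Y \<longlonglongrightarrow> y"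
    using limit_belowE[OF h(1)] by metis
  obtain C where C: "\<And>n. C n \<in> seg (P n) (Y n)" "C \<longlonglongrightarrow> c"
    using seg_limit[OF limit_below_X[OF h(1)] h(2) below_X[OF PY(1)] PY(2,3)] by metis
  have "P n \<preceq> C n" "C n \<preceq> Y n" for n using mem_seg_iff_between[OF PY(1)] C(1) by auto
  then show "p \<sqsubseteq> c" "c \<sqsubseteq> y" using limit_belowI PY C by blast+
qed

lemma below_limit_below_trans:
  assumes "q \<preceq> p" "p \<sqsubseteq> y"
  shows "q \<sqsubseteq> y"
proof -
  obtain P Y where PY: "\<And>n. P n \<preceq> Y n" "P \<longlonglongrightarrow> p" "Y \<longlonglongrightarrow> y"
    using limit_belowE[OF assms(2)] by metis
  obtain C where C: "\<And>n. C n \<in> seg t (P n)" "C \<longlonglongrightarrow> q"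
    using seg_limit[OF base below_X(2)[OF assms(1)], of q "\<lambda>n. t" P] assms(1) base
      below_X(1)[OF PY(1)] PY(2) by (auto simp: below_def)
  have "C n \<preceq> P n" for n using C(1) below_X(1)[OF PY(1)] by (simp add: below_def)
  then have "C n \<preceq> Y n" for n using PY(1) below_trans by blast
  then show ?thesis using limit_belowI C(2) PY(3) by blast
qed

text \<open>Upper semicontinuity of the arc from \<open>t\<close> at the point \<open>a\<close>,
  stated through the two relations so that homeomorphisms visibly preserve it.\<close>

definition smooth_points :: "'a set" where
  "smooth_points = {a \<in> X. \<forall>p. p \<sqsubseteq> a \<longrightarrow> p \<preceq> a}"

lemma smooth_points_smooth_at:
  assumes a: "a \<in> smooth_points"
  shows "smooth_at_wrt X t a"
  unfolding smooth_at_wrt_def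
proof (intro allI impI)
  fix s :: "nat \<Rightarrow> 'a" assume "range s \<subseteq> X \<and> s \<longlonglongrightarrow> a"
  then have s: "\<And>n. s n \<in> X" "s \<longlonglongrightarrow> a" by auto
  have aX: "a \<in> X" using a by (simp add: smooth_points_def)
  \<comment> \<open>Points of the nearby arcs staying away from \<open>seg t a\<close> would
    accumulate at some \<open>p \<sqsubseteq> a\<close> off that arc.\<close>
  have upper: "eventually (\<lambda>n. \<forall>p\<in>seg t (s n). infdist p (seg t a) < r) sequentially" if r: "r > 0" for r
  proof (rule ccontr)
    assume neg: "\<not> ?thesis"
    obtain f :: "nat \<Rightarrow> nat" where f: "strict_mono f"
      "\<forall>n. \<not> (\<forall>p\<in>seg t (s (f n)). infdist p (seg t a) < r)"
      using not_eventually_sequentiallyD[OF neg] by blast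
    then have "\<forall>n. \<exists>p. p \<in> seg t (s (f n)) \<and> r \<le> infdist p (seg t a)" by (meson not_less)
    from choice[OF this] obtain P where "\<forall>n. P n \<in> seg t (s (f n)) \<and> r \<le> infdist (P n) (seg t a)"
      by blast
    then have P: "\<And>n. P n \<in> seg t (s (f n))" "\<And>n. r \<le> infdist (P n) (seg t a)" by auto
    have PX: "P n \<in> X" for n using P(1) seg_subset[OF base s(1)] by blast
    obtain p g where "p \<in> X" and pg: "strict_mono (g :: nat \<Rightarrow> nat)" "(P \<circ> g) \<longlonglongrightarrow> p"
      by (rule subseq_X[OF PX])
    have "(s \<circ> (f \<circ> g)) \<longlonglongrightarrow> a"
      using LIMSEQ_subseq_LIMSEQ[OF s(2) strict_mono_o[OF f(1) pg(1)]] .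
    moreover have "(P \<circ> g) n \<preceq> (s \<circ> (f \<circ> g)) n" for n
      using P(1) s(1) by (simp add: below_def)
    ultimately have "p \<sqsubseteq> a" using limit_belowI pg(2) by blast
    then have "p \<in> seg t a" using a by (auto simp: smooth_points_def below_def)
    moreover have "(\<lambda>n. infdist ((P \<circ> g) n) (seg t a)) \<longlonglongrightarrow> infdist p (seg t a)"
      by (rule tendsto_infdist[OF pg(2)])
    then have "r \<le> infdist p (seg t a)"
      using P(2) by (intro LIMSEQ_le_const) auto
    ultimately show False using r by simp
  qed
  \<comment> \<open>This half uses only lower semicontinuity, through
    \<open>seg_limit\<close>.\<close>
  have lower: "eventually (\<lambda>n. \<forall>b\<in>seg t a. infdist b (seg t (s n)) < r) sequentially" if r: "r > 0" for r
  proof (rule ccontr)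
    assume neg: "\<not> ?thesis"
    obtain f :: "nat \<Rightarrow> nat" where f: "strict_mono f"
      "\<forall>n. \<not> (\<forall>b\<in>seg t a. infdist b (seg t (s (f n))) < r)"
      using not_eventually_sequentiallyD[OF neg] by blast
    then have "\<forall>n. \<exists>b. b \<in> seg t a \<and> r \<le> infdist b (seg t (s (f n)))" by (meson not_less)
    from choice[OF this] obtain B where "\<forall>n. B n \<in> seg t a \<and> r \<le> infdist (B n) (seg t (s (f n)))"
      by blast
    then have B: "\<And>n. B n \<in> seg t a" "\<And>n. r \<le> infdist (B n) (seg t (s (f n)))" by auto
    obtain b g where bg: "b \<in> seg t a" "strict_mono (g :: nat \<Rightarrow> nat)" "(B \<circ> g) \<longlonglongrightarrow> b"
      using seq_compactE[OF compact_imp_seq_compact[OF seg_compact[OF base aX]]] B(1) by blast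
    have "(s \<circ> (f \<circ> g)) \<longlonglongrightarrow> a"
      using LIMSEQ_subseq_LIMSEQ[OF s(2) strict_mono_o[OF f(1) bg(2)]] .
    then obtain C where C: "\<And>n. C n \<in> seg t ((s \<circ> (f \<circ> g)) n)" "C \<longlonglongrightarrow> b"
      using seg_limit[OF base aX bg(1), of "\<lambda>n. t" "s \<circ> (f \<circ> g)"] s(1) base by auto
    have "r \<le> dist ((B \<circ> g) n) (C n)" for n
      using B(2)[of "g n"] infdist_le[OF C(1)[of n], of "(B \<circ> g) n"] by simp
    moreover have "(\<lambda>n. dist ((B \<circ> g) n) (C n)) \<longlonglongrightarrow> dist b b"
      by (rule tendsto_dist[OF bg(3) C(2)])
    ultimately have "r \<le> dist b b" by (intro LIMSEQ_le_const) auto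
    then show False using r by simp
  qed
  show "(\<lambda>n. hausdorff_dist (seg t (s n)) (seg t a)) \<longlonglongrightarrow> 0"
  proof (rule tendstoI)
    fix e :: real assume "e > 0"
    then have "e / 2 > 0" by simp
    from upper[OF this] lower[OF this]
    show "eventually (\<lambda>n. dist (hausdorff_dist (seg t (s n)) (seg t a)) 0 < e) sequentially"
    proof eventually_elim
      case (elim n)
      have SUP: "0 \<le> (SUP x\<in>A. infdist x B) \<and> (SUP x\<in>A. infdist x B) \<le> e / 2"
        if A: "\<forall>x\<in>A. infdist x B < e / 2" "t \<in> A" for A B :: "'a set"
      proof
        have "bdd_above ((\<lambda>x. infdist x B) ` A)" using A(1) by (meson bdd_aboveI2 less_imp_le)
        then show "0 \<le> (SUP x\<in>A. infdist x B)"
          using A(2) by (intro cSUP_upper2[where x = t]) (auto simp: infdist_nonneg)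
        show "(SUP x\<in>A. infdist x B) \<le> e / 2"
          using A by (intro cSUP_least) (auto intro: less_imp_le)
      qed
      have "t \<in> seg t (s n)" "t \<in> seg t a" using seg_ends(1) base s(1) aX by auto
      then show ?case using SUP[OF elim(1)] SUP[OF elim(2)] \<open>e > 0\<close>
        by (auto simp: hausdorff_dist_def dist_real_def)
    qed
  qed
qed

section \<open>Alternating chains\<close>

text \<open>\<open>alternating n P Q a b\<close> says that the arc from \<open>a\<close> up to \<open>b\<close> visits
  \<open>P, Q, P, Q, \<dots>\<close> in this order, \<open>n\<close> visits altogether.\<close>

primrec alternating :: "nat \<Rightarrow> 'a set \<Rightarrow> 'a set \<Rightarrow> 'a \<Rightarrow> 'a \<Rightarrow> bool" where
  "alternating 0 P Q a b \<longleftrightarrow> a \<preceq> b"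
| "alternating (Suc n) P Q a b \<longleftrightarrow> (\<exists>g\<in>P. a \<preceq> g \<and> alternating n Q P g b)"

lemma alternating_below: "alternating n P Q a b \<Longrightarrow> a \<preceq> b"
  by (induction n arbitrary: P Q a) (auto intro: below_trans)

lemma alternating_mono_left: "alternating n P Q a b \<Longrightarrow> a' \<preceq> a \<Longrightarrow> alternating n P Q a' b"
  by (cases n) (auto intro: below_trans)

text \<open>Each visit exchanges the roles of the two sets, so the parity of \<open>n\<close>
  decides with which of them the second chain must begin.\<close>

lemma alternating_append:
  assumes "alternating n P Q a b"
    and "alternating m (if even n then P else Q) (if even n then Q else P) b c"
  shows "alternating (n + m) P Q a c"
  using assms
proof (induction n arbitrary: P Q a)
  case 0
  then show ?case using alternating_mono_left by auto
next
  case (Suc n)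
  then obtain g where g: "g \<in> P" "a \<preceq> g" "alternating n Q P g b" by auto
  have "alternating (n + m) Q P g c" using Suc.IH[OF g(3)] Suc.prems(2) by (simp split: if_splits)
  then show ?case using g by auto
qed

lemma alternating_split:
  assumes "alternating n P Q a b" "a \<preceq> p" "p \<preceq> b"
  obtains i j where "i + j = n" "alternating i P Q a p"
    "alternating j (if even i then P else Q) (if even i then Q else P) p b"
  using assms
proof (induction n arbitrary: P Q a thesis)
  case 0
  show ?case by (rule "0.prems"(1)[of 0 0]) (use "0.prems" in auto)
next
  case (Suc n)
  obtain g where g: "g \<in> P" "a \<preceq> g" "alternating n Q P g b" using Suc.prems(2) by auto
  have "g \<preceq> p \<or> p \<preceq> g" using below_linear alternating_below[OF g(3)] Suc.prems(4) by blast
  then show ?case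
  proof
    assume "g \<preceq> p"
    then obtain i j where "i + j = n" "alternating i Q P g p"
      "alternating j (if even i then Q else P) (if even i then P else Q) p b"
      using Suc.IH[OF _ g(3) _ Suc.prems(4)] by metis
    then show ?case using g by (intro Suc.prems(1)[of "Suc i" j]) (auto split: if_splits)
  next
    assume "p \<preceq> g"
    then show ?case using g Suc.prems(3) by (intro Suc.prems(1)[of 0 "Suc n"]) auto
  qed
qed

text \<open>A visit \<open>g\<close> is a limit of points on the approximating arcs, and the
  induction continues above those points. This is why the lower endpoint is allowed to vary.\<close>

lemma alternating_eventually:
  assumes "alternating n P Q a b" "open P" "open Q"
    and "\<And>k. A k \<preceq> B k" "A \<longlonglongrightarrow> a" "B \<longlonglongrightarrow> b"
  shows "eventually (\<lambda>k. alternating n P Q (A k) (B k)) sequentially"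
  using assms
proof (induction n arbitrary: P Q a A)
  case (Suc n)
  obtain g where g: "g \<in> P" "a \<preceq> g" "alternating n Q P g b" using Suc.prems(1) by auto
  have "g \<preceq> b" using alternating_below[OF g(3)] .
  then have ab: "a \<preceq> b" "g \<in> seg a b"
    using mem_seg_iff_between below_trans g(2) by blast+
  obtain C where C: "\<And>k. C k \<in> seg (A k) (B k)" "C \<longlonglongrightarrow> g"
    using seg_limit[OF below_X[OF ab(1)] ab(2) below_X[OF Suc.prems(4)] Suc.prems(5,6)] by metis
  have C': "A k \<preceq> C k" "C k \<preceq> B k" for k using C(1) mem_seg_iff_between[OF Suc.prems(4)] by auto
  have "eventually (\<lambda>k. alternating n Q P (C k) (B k)) sequentially"
    using Suc.IH[OF g(3) Suc.prems(3,2) C'(2) C(2) Suc.prems(6)] .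
  moreover have "eventually (\<lambda>k. C k \<in> P) sequentially"
    using topological_tendstoD[OF C(2) Suc.prems(2) g(1)] .
  ultimately show ?case by eventually_elim (use C' in auto)
qed simp

text \<open>Consecutive visits are at least \<delta> apart in \<open>X\<close>, so by uniform
  continuity of a parametrization they are at least \<eta> apart in the parameter interval.\<close>

lemma alternating_bounded:
  assumes "0 < \<delta>" "\<And>u v. u \<in> U \<Longrightarrow> v \<in> V \<Longrightarrow> \<delta> \<le> dist u v" "x \<in> X"
  shows "\<exists>N. \<forall>n. alternating n U V t x \<longrightarrow> n \<le> N"
proof (cases "x = t")
  case True
  have "n \<le> 1" if alt: "alternating n U V t x" for n
  proof (rule ccontr)
    assume "\<not> n \<le> 1"
    then obtain k where k: "n = Suc (Suc k)" by (cases n; cases "n - 1") auto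
    then obtain u v where uv: "u \<in> U" "v \<in> V" "t \<preceq> u" "u \<preceq> v" "alternating k U V v t"
      using alt unfolding True k by auto
    have "v \<preceq> t" using alternating_below[OF uv(5)] .
    then have "u = t" "v = t" using uv(3,4) below_antisym below_trans by blast+
    then show False using assms(1) assms(2)[OF uv(1,2)] by simp
  qed
  then show ?thesis by blast
next
  case False
  obtain g where g: "continuous_on {0..1::real} g" "inj_on g {0..1}" "seg t x = g ` {0..1}"
    "\<And>s. s \<in> {0..1} \<Longrightarrow> seg t (g s) = g ` {0..s}"
    using seg_param[OF base assms(3)] False by metis
  obtain \<eta> where \<eta>: "\<eta> > 0" "\<And>s s'. s \<in> {0..1} \<Longrightarrow> s' \<in> {0..1} \<Longrightarrow> dist s' s < \<eta> \<Longrightarrow> dist (g s') (g s) < \<delta>"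
    using compact_uniformly_continuous[OF g(1) compact_Icc] assms(1)
    unfolding uniformly_continuous_on_def by meson
  have mono: "s \<le> s'" if h: "s \<in> {0..1}" "s' \<in> {0..1}" "g s \<preceq> g s'" for s s'
  proof -
    have "g s \<in> g ` {0..s'}" using h g(4) by (simp add: below_def)
    then obtain u where u: "u \<in> {0..s'}" "g s = g u" by blast
    then have "s = u" using h by (intro inj_onD[OF g(2)]) auto
    then show ?thesis using u by simp
  qed
  have param: "\<exists>s\<in>{0..1}. u = g s" if "u \<preceq> x" for u
    using that g(3) by (auto simp: below_def)
  \<comment> \<open>The hypothesis \<open>g s \<in> Q\<close> records the preceding visit, made in
    the set opposite to the next one. Every further visit uses up a parameter length of at least
    \<eta>.\<close>
  have main: "real n * \<eta> \<le> 1 - s"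
    if "s \<in> {0..1}" "g s \<in> Q" "alternating n P Q (g s) x"
      "\<And>u v. u \<in> P \<Longrightarrow> v \<in> Q \<Longrightarrow> \<delta> \<le> dist u v" for n s P Q
    using that
  proof (induction n arbitrary: s P Q)
    case (Suc n)
    obtain u where u: "u \<in> P" "g s \<preceq> u" "alternating n Q P u x" using Suc.prems(3) by auto
    obtain s' where s': "s' \<in> {0..1}" "u = g s'" using param[OF alternating_below[OF u(3)]] by blast
    have "s \<le> s'" using mono[OF Suc.prems(1) s'(1)] u(2) s'(2) by simp
    have "\<delta> \<le> dist (g s') (g s)" using Suc.prems(4)[OF u(1) Suc.prems(2)] s'(2) by simp
    then have "\<eta> \<le> s' - s"
      using \<eta>(2)[OF Suc.prems(1) s'(1)] \<open>s \<le> s'\<close> by (fastforce simp: dist_real_def)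
    moreover have "real n * \<eta> \<le> 1 - s'"
    proof (rule Suc.IH[of s' P Q])
      show "\<delta> \<le> dist a b" if "a \<in> Q" "b \<in> P" for a b
        using Suc.prems(4)[OF that(2,1)] by (simp add: dist_commute)
    qed (use s' u in auto)
    ultimately show ?case by (simp add: algebra_simps)
  qed auto
  \<comment> \<open>The first visit has no predecessor and costs no length, hence the
    \<open>Suc\<close>.\<close>
  have "n \<le> Suc (nat \<lceil>1 / \<eta>\<rceil>)" if alt: "alternating n U V t x" for n
  proof (cases n)
    case (Suc k)
    then obtain u where u: "u \<in> U" "alternating k V U u x" using alt by auto
    obtain s where s: "s \<in> {0..1}" "u = g s" using param[OF alternating_below[OF u(2)]] by blast
    have "real k * \<eta> \<le> 1 - s"
    proof (rule main[of s U k V])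
      show "\<delta> \<le> dist a b" if "a \<in> V" "b \<in> U" for a b
        using assms(2)[OF that(2,1)] by (simp add: dist_commute)
    qed (use s u in auto)
    then have "real k * \<eta> \<le> 1" using s by simp
    then have "real k \<le> 1 / \<eta>" using \<eta>(1) by (simp add: field_simps)
    then show ?thesis using Suc by linarith
  qed simp
  then show ?thesis by blast
qed

lemma openin_alternating:
  assumes "open P" "open Q" "Y \<subseteq> X"
  shows "openin (top_of_set Y) {x \<in> Y. alternating n P Q t x}"
proof (rule openin_subset_sequentially)
  fix x s assume h: "x \<in> {x \<in> Y. alternating n P Q t x}" "\<And>k::nat. s k \<in> Y" "s \<longlonglongrightarrow> x"
  have "eventually (\<lambda>k. alternating n P Q t (s k)) sequentially"
    using h assms(3) base_below by (intro alternating_eventually[OF _ assms(1,2)]) auto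
  then show "eventually (\<lambda>k. s k \<in> {x \<in> Y. alternating n P Q t x}) sequentially"
    using h(2) by simp
qed auto

text \<open>Otherwise every open set contains points whose arcs run close to \<open>t\<close> and back once more
  than those of given points, and by Baire's theorem some arc oscillates infinitely often.\<close>

lemma limit_below_base_trivial:
  assumes all: "\<And>p. p \<in> X \<Longrightarrow> p \<sqsubseteq> t"
  shows "X = {t}"
proof (rule ccontr)
  assume "X \<noteq> {t}"
  then obtain z where z: "z \<in> X" "z \<noteq> t" using base by auto
  \<comment> \<open>A third of the distance, so that the balls of radius \<open>d\<close> about
    \<open>t\<close> and \<open>z\<close> leave a gap of at least \<open>d\<close>.\<close>
  define d where "d = dist z t / 3"
  have d: "d > 0" using z by (simp add: d_def)
  define U where "U = ball t d"
  define V where "V = ball z d"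
  have UV: "open U" "open V" "t \<in> U" "z \<in> V" using d by (auto simp: U_def V_def)
  have sep: "d \<le> dist u v" if "u \<in> U" "v \<in> V" for u v
  proof -
    have "dist z t \<le> dist z v + dist v u + dist u t" by metric
    moreover have "dist t u < d" "dist z v < d" using that by (auto simp: U_def V_def)
    ultimately show ?thesis by (simp add: d_def dist_commute)
  qed
  have dense: "\<exists>x\<in>G \<inter> X. alternating (2 * k) U V t x"
    if G: "open G" "G \<subseteq> V" "G \<inter> X \<noteq> {}" for k G
  proof (induction k)
    case 0
    obtain x where "x \<in> G \<inter> X" using G(3) by blast
    then show ?case using base_below by auto
  next
    case (Suc k)
    then obtain b where b: "b \<in> G" "b \<in> X" "alternating (2 * k) U V t b" by auto
    obtain B A where BA: "\<And>n. B n \<preceq> A n" "B \<longlonglongrightarrow> b" "A \<longlonglongrightarrow> t"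
      using limit_belowE[OF all[OF b(2)]] by metis
    have "eventually (\<lambda>n. alternating (2 * k) U V t (B n)) sequentially"
      using below_X(1)[OF BA(1)] base_below BA(2)
      by (intro alternating_eventually[OF b(3) UV(1,2)]) auto
    moreover have "eventually (\<lambda>n. B n \<in> G) sequentially"
      using topological_tendstoD[OF BA(2) G(1) b(1)] .
    moreover have "eventually (\<lambda>n. A n \<in> U) sequentially"
      using topological_tendstoD[OF BA(3) UV(1,3)] .
    ultimately have "eventually (\<lambda>n. alternating (2 * k) U V t (B n) \<and> B n \<in> G \<and> A n \<in> U) sequentially"
      by (simp add: eventually_conj)
    then obtain n where n: "alternating (2 * k) U V t (B n)" "B n \<in> G" "A n \<in> U"
      using eventually_happens'[OF sequentially_bot] by blast
    define b' a where "b' = B n" and "a = A n"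
    have ba: "b' \<preceq> a" using BA(1) by (simp add: b'_def a_def)
    have aX: "a \<in> X" using below_X(2)[OF ba] .
    have alt: "alternating (2 * k + 1) U V t a"
    proof -
      have "alternating 1 U V b' a" using n(3) ba below_refl[OF aX] by (auto simp: a_def)
      then show ?thesis
        using alternating_append[OF n(1), of 1 a] by (simp add: b'_def del: alternating.simps)
    qed
    \<comment> \<open>The arc from \<open>a\<close> down to \<open>t\<close> contains
      \<open>b'\<close>. Hence the arcs from \<open>C n\<close> up to \<open>D n\<close>, which lead
      from near \<open>a\<close> to near \<open>t\<close>, pass near \<open>b'\<close>: the points
      \<open>E n\<close> found there lie above \<open>C n\<close> and again in \<open>G\<close>,
      which gives the return to \<open>V\<close>.\<close>
    obtain C D where CD: "\<And>n. C n \<preceq> D n" "C \<longlonglongrightarrow> a" "D \<longlonglongrightarrow> t"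
      using limit_belowE[OF all[OF aX]] by metis
    have b'a: "b' \<in> seg a t" using ba seg_sym[OF base aX] by (simp add: below_def)
    obtain E where E: "\<And>n. E n \<in> seg (C n) (D n)" "E \<longlonglongrightarrow> b'"
      using seg_limit[OF aX base b'a below_X[OF CD(1)] CD(2,3)] by metis
    have E': "C n \<preceq> E n" "E n \<in> X" for n
      using E(1) mem_seg_iff_between[OF CD(1)] below_X by blast+
    have "eventually (\<lambda>n. alternating (2 * k + 1) U V t (C n)) sequentially"
      using below_X(1)[OF CD(1)] base_below CD(2)
      by (intro alternating_eventually[OF alt UV(1,2)]) auto
    moreover have "eventually (\<lambda>n. E n \<in> G) sequentially"
      using topological_tendstoD[OF E(2) G(1)] n(2) by (simp add: b'_def)
    ultimately have "eventually (\<lambda>n. alternating (2 * k + 1) U V t (C n) \<and> E n \<in> G) sequentially"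
      by (rule eventually_conj)
    then obtain m where m: "alternating (2 * k + 1) U V t (C m)" "E m \<in> G"
      using eventually_happens'[OF sequentially_bot] by blast
    have "alternating (2 * Suc k) U V t (E m)"
    proof -
      have "E m \<in> V" using m(2) G(2) by blast
      then have "alternating 1 V U (C m) (E m)"
        using E'(1)[of m] below_refl[OF E'(2)[of m]] by auto
      then show ?thesis
        using alternating_append[OF m(1), of 1 "E m"] by (simp del: alternating.simps)
    qed
    then show ?case using m(2) E'(2) by blast
  qed
  let ?H = "\<lambda>k. {x \<in> X. alternating (2 * k) U V t x}"
  have "V \<inter> X \<noteq> {}" using UV(4) z(1) by blast
  then obtain x where x: "x \<in> V" "x \<in> X" "\<And>H. H \<in> range ?H \<Longrightarrow> x \<in> H"
  proof (rule compact_Baire_dense_open[OF compact_X UV(2), of "range ?H"])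
    show "countable (range ?H)" by simp
    show "openin (top_of_set X) H" if "H \<in> range ?H" for H
      using that openin_alternating[OF UV(1,2) order_refl] by blast
    show "G \<inter> H \<noteq> {}" if "H \<in> range ?H" "open G" "G \<subseteq> V" "G \<inter> X \<noteq> {}" for H G
      using that(1) dense[OF that(2-4)] by blast
  qed blast
  obtain N where N: "\<And>n. alternating n U V t x \<Longrightarrow> n \<le> N"
    using alternating_bounded[OF d sep x(2)] by blast
  have "alternating (2 * Suc N) U V t x" using x(3) by blast
  then show False using N[of "2 * Suc N"] by simp
qed

end

section \<open>Legs of a fan\<close>

lemma classical_order_ge_card:
  assumes "finite \<A>" "arc_star X p \<A>"
  shows "enat (card \<A>) \<le> classical_order X p"
  unfolding classical_order_def using assms by (intro SUP_upper) simp

locale fan_space = pointed_dendroid +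
  assumes fan: "fan X" and top: "t = fan_top X"
begin

lemma ramification_iff_top: "ramification_point X p \<longleftrightarrow> p = t"
proof -
  have ex1: "\<exists>!p. ramification_point X p" using fan by (simp add: fan_def)
  have "ramification_point X t"
    unfolding top fan_top_def by (rule theI'[OF ex1])
  then show ?thesis using ex1 by blast
qed

lemma order_top: "classical_order X t > 2"
  using ramification_iff_top[of t] by (simp add: ramification_point_def)

lemma not_singleton: "X \<noteq> {t}"
proof
  assume X: "X = {t}"
  obtain \<A> where A: "arc_star X t \<A>" "2 < enat (card \<A>)"
    using order_top unfolding classical_order_def less_SUP_iff by blast
  then have "\<A> \<noteq> {}" by (metis card.empty not_less_zero zero_enat_def)
  then obtain A q where "arc_joining X t q A" using A(1) unfolding arc_star_def by blast
  then obtain g where g: "arc g" "pathstart g = t" "pathfinish g = q" "path_image g \<subseteq> X"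
    unfolding arc_joining_def by metis
  then show False
    using X arc_distinct_ends[OF g(1)] pathfinish_in_path_image[of g] by auto
qed

lemma arc_star_three:
  assumes X: "m \<in> X" "a \<in> X" "b \<in> X" "c \<in> X" and ne: "a \<noteq> m" "b \<noteq> m" "c \<noteq> m"
    and I: "seg m a \<inter> seg m b = {m}" "seg m a \<inter> seg m c = {m}" "seg m b \<inter> seg m c = {m}"
  shows "m = t"
proof -
  let ?A = "{seg m a, seg m b, seg m c}"
  have mem: "a \<in> seg m a" "b \<in> seg m b" "c \<in> seg m c"
    using seg_ends(2)[OF X(1)] X by auto
  have d: "seg m a \<noteq> seg m b" "seg m a \<noteq> seg m c" "seg m b \<noteq> seg m c"
    using mem I ne by auto
  have "arc_joining X m x (seg m x)" if "x \<in> {a, b, c}" for x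
    using that seg_joining[OF X(1), of x] X ne by auto
  then have "arc_star X m ?A"
    unfolding arc_star_def pairwise_def using I by (auto simp: Int_commute)
  then have "enat (card ?A) \<le> classical_order X m" by (intro classical_order_ge_card) auto
  moreover have "card ?A = 3" using d by simp
  moreover have "(2::enat) < enat 3" by (simp add: numeral_eq_enat)
  ultimately have "2 < classical_order X m" by (metis order_less_le_trans)
  then have "ramification_point X m" using X(1) by (simp add: ramification_point_def)
  then show ?thesis using ramification_iff_top by simp
qed

text \<open>If the last common point \<open>m\<close> of the two arcs were not \<open>t\<close>, the
  arcs from \<open>m\<close> to \<open>t\<close>, \<open>y\<close> and \<open>z\<close> would meet
  only in \<open>m\<close> and make it a second ramification point.\<close>

lemma incomparable_seg_Int:
  assumes y: "y \<in> X" and z: "z \<in> X" and inc: "\<not> y \<preceq> z" "\<not> z \<preceq> y"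
  shows "seg t y \<inter> seg t z = {t}"
proof -
  let ?K = "seg t y \<inter> seg t z"
  have "closed ?K" using seg_closed[OF base y] seg_closed[OF base z] by auto
  moreover have tK: "t \<in> ?K" using seg_ends(1)[OF base] y z by blast
  ultimately obtain m where m: "m \<in> ?K" "?K \<subseteq> seg t m"
    using closed_subset_seg_max[OF base y, of ?K] by blast
  have mX: "m \<in> X" using m(1) seg_subset[OF base y] by blast
  have my: "m \<in> seg t y" and mz: "m \<in> seg t z" using m(1) by auto
  have "m = t"
  proof (rule ccontr)
    assume mt: "m \<noteq> t"
    have ne: "t \<noteq> m" "y \<noteq> m" "z \<noteq> m"
      using mt my mz inc y z by (auto simp: below_def)
    have ty: "seg m t \<inter> seg m y = {m}" and tz: "seg m t \<inter> seg m z = {m}"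
      using seg_Int[OF base y my] seg_Int[OF base z mz] seg_sym[OF base mX] by auto
    have "seg m y \<inter> seg m z \<subseteq> ?K"
      using seg_mono[OF base y my seg_ends(2)[OF base y]] seg_mono[OF base z mz seg_ends(2)[OF base z]]
      by blast
    then have "seg m y \<inter> seg m z \<subseteq> seg m t \<inter> seg m y"
      using m(2) seg_sym[OF base mX] by auto
    moreover have "m \<in> seg m y \<inter> seg m z" using seg_ends(1)[OF mX] y z by blast
    ultimately have yz: "seg m y \<inter> seg m z = {m}" using ty by blast
    show False using arc_star_three[OF mX base y z ne ty tz yz] mt by simp
  qed
  then show ?thesis using m(2) tK by auto
qed

text \<open>The arc from \<open>y\<close> to \<open>z\<close> lies in the union of the arcs from
  \<open>t\<close>, which have only \<open>t\<close> in common; being connected, it cannot avoid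
  \<open>t\<close>.\<close>

lemma top_in_seg_incomparable:
  assumes y: "y \<in> X" and z: "z \<in> X" and inc: "\<not> y \<preceq> z" "\<not> z \<preceq> y"
  shows "t \<in> seg y z"
proof -
  have "seg y z \<subseteq> seg t y \<union> seg t z"
    using seg_ends[OF base y] seg_ends[OF base z] seg_subset[OF base y] seg_subset[OF base z]
    by (intro seg_minimal continuum_Un seg_continuum base y z) auto
  then have cov: "seg y z = (seg y z \<inter> seg t y) \<union> (seg y z \<inter> seg t z)" by blast
  have "seg y z \<inter> seg t y \<noteq> {}" "seg y z \<inter> seg t z \<noteq> {}"
    using seg_ends[OF y z] seg_ends(2)[OF base y] seg_ends(2)[OF base z] by auto
  then have "seg t y \<inter> seg t z \<inter> seg y z \<noteq> {}"
    using connected_closedD[OF seg_connected[OF y z], of "seg t y" "seg t z"] cov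
      seg_closed[OF base y] seg_closed[OF base z] by blast
  then show ?thesis using incomparable_seg_Int[OF assms] by auto
qed

lemma below_comparable:
  assumes "x \<noteq> t" "x \<preceq> y" "x \<preceq> z"
  shows "y \<preceq> z \<or> z \<preceq> y"
proof (rule ccontr)
  assume "\<not> ?thesis"
  then have "seg t y \<inter> seg t z = {t}"
    using incomparable_seg_Int below_X(2)[OF assms(2)] below_X(2)[OF assms(3)] by blast
  then show False using assms by (auto simp: below_def)
qed

definition ends :: "'a set" where
  "ends = {e \<in> X. e \<noteq> t \<and> (\<forall>y. e \<preceq> y \<longrightarrow> y = e)}"

lemma ends_X: "e \<in> ends \<Longrightarrow> e \<in> X" and ends_ne_top: "e \<in> ends \<Longrightarrow> e \<noteq> t"
  and ends_maximal: "e \<in> ends \<Longrightarrow> e \<preceq> y \<Longrightarrow> y = e"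
  by (auto simp: ends_def)

lemma end_unique:
  assumes "x \<noteq> t" "e \<in> ends" "e' \<in> ends" "x \<preceq> e" "x \<preceq> e'"
  shows "e = e'"
  using below_comparable[OF assms(1,4,5)] ends_maximal[OF assms(2)] ends_maximal[OF assms(3)] by blast

text \<open>Whether the arc from \<open>e\<close> to \<open>p\<close> stays on the leg of
  \<open>e\<close> or passes through \<open>t\<close>, it begins with a piece of that leg. This
  moves statements about arbitrary arcs at \<open>e\<close> onto the leg.\<close>

lemma seg_from_end:
  assumes e: "e \<in> ends" and p: "p \<in> X" "p \<noteq> e"
  obtains c where "c \<preceq> e" "c \<noteq> e" "seg c e \<subseteq> seg e p"
proof (cases "p \<preceq> e")
  case True
  then show thesis using that[of p] p seg_sym[OF p(1) ends_X[OF e]] by auto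
next
  case False
  have "\<not> e \<preceq> p" using ends_maximal[OF e] p(2) by blast
  then have "t \<in> seg e p" using top_in_seg_incomparable[OF ends_X[OF e] p(1)] False by blast
  then have "seg t e \<subseteq> seg e p"
    using seg_mono[OF ends_X[OF e] p(1)] seg_ends(1)[OF ends_X[OF e] p(1)] by blast
  then show thesis using that[of t] base_below[OF ends_X[OF e]] ends_ne_top[OF e] by metis
qed

lemma arc_joining_eq_seg:
  assumes "arc_joining X p q A"
  shows "A = seg p q" "p \<in> X" "q \<in> X" "q \<noteq> p"
proof -
  obtain g where g: "arc g" "pathstart g = p" "pathfinish g = q"
    using assms unfolding arc_joining_def by metis
  show ne: "q \<noteq> p" using arc_distinct_ends[OF g(1)] g by simp
  show "A = seg p q" using the_arc_eq[OF dendroid ne[symmetric] assms] by simp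
  show "p \<in> X" "q \<in> X" using arc_joining_continuum[OF assms] by auto
qed

text \<open>A point other than \<open>t\<close> with something above it has one arc down and one up,
  so its order is at least 2. At a maximal point any two arcs share a piece of the leg, so its order
  is 1.\<close>

lemma end_points_eq: "end_points X = ends"
proof
  show "end_points X \<subseteq> ends"
  proof
    fix e assume "e \<in> end_points X"
    then have e: "e \<in> X" "classical_order X e = 1" by (auto simp: end_points_def)
    have et: "e \<noteq> t"
    proof
      assume "e = t"
      then have "(2::enat) < 1" using order_top e(2) by simp
      then show False by (simp add: one_enat_def numeral_eq_enat)
    qed
    moreover have "y = e" if ey: "e \<preceq> y" for y
    proof (rule ccontr)
      assume ye: "y \<noteq> e"
      have y: "y \<in> X" "e \<in> seg t y" using below_X(2)[OF ey] ey by (auto simp: below_def)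
      have I: "seg e t \<inter> seg e y = {e}" using seg_Int[OF base y] seg_sym[OF base e(1)] by simp
      have "arc_star X e {seg e t, seg e y}"
        unfolding arc_star_def pairwise_def
        using I seg_joining[OF e(1) base et] seg_joining[OF e(1) y(1) ye[symmetric]]
        by (auto simp: Int_commute)
      then have "enat (card {seg e t, seg e y}) \<le> classical_order X e"
        by (intro classical_order_ge_card) auto
      moreover have "seg e t \<noteq> seg e y"
        using I seg_ends(2)[OF e(1) base] et by auto
      ultimately show False using e(2) by (simp add: one_enat_def)
    qed
    ultimately show "e \<in> ends" using e(1) by (auto simp: ends_def)
  qed
  show "ends \<subseteq> end_points X"
  proof
    fix e assume e: "e \<in> ends"
    have eX: "e \<in> X" "e \<noteq> t" using e by (auto simp: ends_def)
    have "card \<A> \<le> 1" if A: "finite \<A>" "arc_star X e \<A>" for \<A>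
    proof (rule ccontr)
      assume "\<not> card \<A> \<le> 1"
      then obtain A B where AB: "A \<in> \<A>" "B \<in> \<A>" "A \<noteq> B"
        by (metis A(1) card_le_Suc0_iff_eq One_nat_def)
      then have I: "A \<inter> B = {e}" using A(2) unfolding arc_star_def pairwise_def by blast
      obtain p q where pq: "arc_joining X e p A" "arc_joining X e q B"
        using A(2) AB unfolding arc_star_def by metis
      obtain c where c: "c \<preceq> e" "c \<noteq> e" "seg c e \<subseteq> A"
        using seg_from_end[OF e arc_joining_eq_seg(3,4)[OF pq(1)]] arc_joining_eq_seg(1)[OF pq(1)] by metis
      obtain d where d: "d \<preceq> e" "d \<noteq> e" "seg d e \<subseteq> B"
        using seg_from_end[OF e arc_joining_eq_seg(3,4)[OF pq(2)]] arc_joining_eq_seg(1)[OF pq(2)] by metis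
      have "c \<in> A" "d \<in> B"
        using c(3) d(3) seg_ends(1) below_X(1)[OF c(1)] below_X(1)[OF d(1)] eX(1) by blast+
      moreover have "c \<preceq> d \<or> d \<preceq> c" using below_linear[OF c(1) d(1)] .
      then have "d \<in> A \<or> c \<in> B"
        using c d mem_seg_iff_between by blast
      ultimately show False using I c(2) d(2) by blast
    qed
    then have "classical_order X e \<le> 1"
      unfolding classical_order_def one_enat_def by (intro SUP_least) auto
    moreover have "arc_star X e {seg e t}"
      unfolding arc_star_def using seg_joining[OF eX(1) base eX(2)] by auto
    then have "1 \<le> classical_order X e"
      using classical_order_ge_card[of "{seg e t}" X e] by (simp add: one_enat_def)
    ultimately show "e \<in> end_points X" using eX(1) by (simp add: end_points_def)
  qed
qed

text \<open>If a leg had no end, its closure would contain a dendroid in which some point is a limit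
  of points arbitrarily far up the leg, which is impossible.\<close>

lemma below_end:
  assumes x: "x \<in> X" "x \<noteq> t"
  obtains e where "e \<in> ends" "x \<preceq> e"
proof (rule ccontr)
  assume "\<not> thesis"
  then have none: "\<And>e. e \<in> ends \<Longrightarrow> \<not> x \<preceq> e" using that by blast
  have up: "\<exists>z. y \<preceq> z \<and> z \<noteq> y" if h: "x \<preceq> y" for y
  proof -
    have "y \<noteq> t"
      using h x(2) below_antisym base_below[OF x(1)] by blast
    then show ?thesis
      using none h below_X(2)[OF h] unfolding ends_def by blast
  qed
  \<comment> \<open>\<open>R\<close> is the whole leg through \<open>x\<close>; by assumption it has
    no last point.\<close>
  define R where "R = {z \<in> X. z \<preceq> x \<or> x \<preceq> z}"
  have RX: "R \<subseteq> X" by (auto simp: R_def)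
  have xR: "x \<in> R" and tR: "t \<in> R"
    using x below_refl base base_below by (auto simp: R_def)
  have Rdown: "c \<in> R" if "c \<preceq> z" "z \<in> R" for c z
  proof -
    have "z \<preceq> x \<or> x \<preceq> z" using that(2) by (simp add: R_def)
    then have "c \<preceq> x \<or> x \<preceq> c" using that(1) below_trans below_linear by blast
    then show ?thesis using below_X(1)[OF that(1)] by (simp add: R_def)
  qed
  have Rlin: "y \<preceq> z \<or> z \<preceq> y" if "y \<in> R" "z \<in> R" for y z
    using that below_linear below_trans below_comparable[OF x(2)] unfolding R_def by blast
  have Rup: "\<exists>z\<in>R. y \<preceq> z \<and> z \<noteq> y" if y: "y \<in> R" for y
  proof (cases "x \<preceq> y")
    case True
    then obtain z where "y \<preceq> z" "z \<noteq> y" using up by blast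
    moreover then have "z \<in> R" using True below_trans below_X(2) unfolding R_def by blast
    ultimately show ?thesis by blast
  next
    case False
    then have "y \<preceq> x" "x \<noteq> y" using y below_refl[OF x(1)] by (auto simp: R_def)
    then show ?thesis using xR by blast
  qed
  \<comment> \<open>Tails of the leg. Their closures are continua that decrease along the leg, so by
    compactness they have a common point.\<close>
  define Tl where "Tl y = {z \<in> R. y \<preceq> z}" for y
  define K where "K y = closure (Tl y)" for y
  have seg_Tl: "seg y z \<subseteq> Tl y" if "z \<in> Tl y" for y z
    using that Rdown mem_seg_iff_between unfolding Tl_def by blast
  have Tl_self: "y \<in> Tl y" if "y \<in> R" for y
    using that below_refl RX by (auto simp: Tl_def)
  have Tl_anti: "Tl z \<subseteq> Tl y" if "y \<preceq> z" for y z
    using that below_trans unfolding Tl_def by blast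
  have K_anti: "K z \<subseteq> K y" if "y \<preceq> z" for y z
    using closure_mono[OF Tl_anti[OF that]] by (simp add: K_def)
  have Tl_K: "Tl y \<subseteq> K y" for y by (simp add: K_def closure_subset)
  have KX: "K y \<subseteq> X" for y
    unfolding K_def using RX compact_imp_closed[OF compact_X]
    by (intro closure_minimal) (auto simp: Tl_def)
  have K_cont: "continuum (K y)" if y: "y \<in> R" for y
  proof -
    have eq: "Tl y = (\<Union>z\<in>Tl y. seg y z)"
    proof
      show "Tl y \<subseteq> (\<Union>z\<in>Tl y. seg y z)"
        using seg_ends(2) y RX unfolding Tl_def by blast
      show "(\<Union>z\<in>Tl y. seg y z) \<subseteq> Tl y" using seg_Tl by blast
    qed
    have "connected (\<Union>z\<in>Tl y. seg y z)"
    proof (rule connected_Union)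
      show "connected S" if "S \<in> seg y ` Tl y" for S
        using that y RX seg_connected by (auto simp: Tl_def)
      have "y \<in> \<Inter> (seg y ` Tl y)" using seg_ends(1) y RX by (auto simp: Tl_def)
      then show "\<Inter> (seg y ` Tl y) \<noteq> {}" by blast
    qed
    then have "connected (K y)" using eq unfolding K_def by (metis connected_imp_connected_closure)
    moreover have "compact (K y)"
      using compact_X KX closed_closure unfolding K_def by (metis compact_Int_closed inf.absorb_iff2)
    ultimately show ?thesis using Tl_self[OF y] Tl_K by (auto simp: continuum_def)
  qed
  have "X \<inter> (\<Inter>y\<in>R. K y) \<noteq> {}"
  proof (rule compact_imp_fip_image[OF compact_X])
    show "closed (K y)" if "y \<in> R" for y by (simp add: K_def)
    fix I assume I: "finite I" "I \<subseteq> R"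
    then have "\<exists>u\<in>R. \<forall>y\<in>I. y \<preceq> u"
    proof (induction I rule: finite_induct)
      case empty then show ?case using xR by blast
    next
      case (insert y F)
      then obtain u where u: "u \<in> R" "\<forall>y\<in>F. y \<preceq> u" by auto
      have yR: "y \<in> R" using insert.prems by simp
      have "u \<preceq> y \<or> y \<preceq> u" using Rlin[OF u(1) yR] .
      then show ?case
      proof
        assume "u \<preceq> y"
        then have "\<forall>z\<in>insert y F. z \<preceq> y" using u(2) below_trans below_refl yR RX by blast
        then show ?thesis using yR by blast
      qed (use u in blast)
    qed
    then obtain u where u: "u \<in> R" "\<forall>y\<in>I. y \<preceq> u" by blast
    then have "u \<in> X \<inter> (\<Inter>y\<in>I. K y)" using K_anti Tl_K Tl_self RX by blast
    then show "X \<inter> (\<Inter>y\<in>I. K y) \<noteq> {}" by blast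
  qed
  then obtain q0 where q0: "q0 \<in> X" "\<And>y. y \<in> R \<Longrightarrow> q0 \<in> K y" by blast
  \<comment> \<open>The common point has to be on the leg. If \<open>q0\<close> is not, every arc
    from it to a point of the leg beyond \<open>x\<close> passes through \<open>t\<close>, so
    \<open>t\<close> itself belongs to all the closures.\<close>
  have "\<exists>q\<in>R. \<forall>y\<in>R. q \<in> K y"
  proof (cases "q0 \<in> R")
    case True then show ?thesis using q0 by blast
  next
    case False
    have "t \<in> K y" if y: "y \<in> R" for y
    proof -
      obtain y' where y': "y' \<in> R" "y \<preceq> y'" "x \<preceq> y'"
        using Rlin[OF xR y] y xR below_refl RX by blast
      have "\<not> q0 \<preceq> y'" using False Rdown y'(1) by blast
      moreover have "\<not> y' \<preceq> q0"
        using False y'(3) below_trans q0(1) unfolding R_def by blast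
      moreover have y'X: "y' \<in> X" using y'(1) RX by blast
      ultimately have "t \<in> seg q0 y'" using top_in_seg_incomparable q0(1) by blast
      moreover have "seg q0 y' \<subseteq> K y'"
        using K_cont[OF y'(1)] KX q0(2)[OF y'(1)] Tl_self[OF y'(1)] Tl_K by (intro seg_minimal) auto
      ultimately show ?thesis using K_anti[OF y'(2)] by blast
    qed
    then show ?thesis using tR by blast
  qed
  then obtain q where q: "q \<in> R" "\<And>y. y \<in> R \<Longrightarrow> q \<in> K y" by blast
  have qX: "q \<in> X" using q(1) RX by blast
  let ?Y = "K q"
  have qY: "q \<in> ?Y" using q by blast
  have Y: "pointed_dendroid ?Y q"
    using subdendroid(1)[OF dendroid K_cont[OF q(1)] KX] qY by unfold_locales
  have arcs: "the_arc ?Y a b = seg a b" if "a \<in> ?Y" "b \<in> ?Y" for a b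
    using subdendroid(2)[OF dendroid K_cont[OF q(1)] KX that] .
  \<comment> \<open>Seen from the new base \<open>q\<close>, the point \<open>p\<close> lies below
    every \<open>w n\<close>, while \<open>w n\<close> tends to \<open>q\<close>. Thus the whole of
    \<open>K q\<close> collapses to its base in the limit, which is the excluded situation.\<close>
  have lim: "pointed_dendroid.limit_below ?Y q p q" if p: "p \<in> Tl q" for p
  proof -
    have pR: "p \<in> R" and qp: "q \<preceq> p" using p by (auto simp: Tl_def)
    have "q \<in> closure (Tl p)" using q(2)[OF pR] by (simp add: K_def)
    then obtain w where w: "\<forall>n. w n \<in> Tl p" "w \<longlonglongrightarrow> q"
      unfolding closure_sequential by blast
    have "pointed_dendroid.below ?Y q p (w n)" for n
    proof -
      have wn: "p \<preceq> w n" "w n \<in> Tl q" using w(1) Tl_anti[OF qp] by (auto simp: Tl_def)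
      have "p \<in> seg q (w n)"
        using mem_seg_iff_between[OF below_trans[OF qp wn(1)]] qp wn(1) by blast
      then show ?thesis
        using arcs[OF qY] wn(2) Tl_K unfolding pointed_dendroid.below_def[OF Y] by blast
    qed
    then show ?thesis
      using pointed_dendroid.limit_belowI[OF Y, of "\<lambda>n. p" w p q] w(2) by simp
  qed
  have "pointed_dendroid.limit_below ?Y q p q" if p: "p \<in> ?Y" for p
  proof -
    obtain s where s: "\<forall>n. s n \<in> Tl q" "s \<longlonglongrightarrow> p"
      using p unfolding K_def closure_sequential by blast
    then show ?thesis
      using pointed_dendroid.limit_below_closed[OF Y, of s "\<lambda>n. q" p q] lim by simp
  qed
  then have "?Y = {q}" using pointed_dendroid.limit_below_base_trivial[OF Y] by blast
  moreover obtain z where "z \<in> R" "q \<preceq> z" "z \<noteq> q" using Rup[OF q(1)] by blast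
  moreover then have "z \<in> ?Y" using Tl_K by (auto simp: Tl_def)
  ultimately show False by blast
qed

lemma exists_end: obtains e where "e \<in> ends"
proof -
  obtain x where x: "x \<in> X" "x \<noteq> t" using not_singleton base by blast
  obtain e where "e \<in> ends" "x \<preceq> e" by (rule below_end[OF x])
  then show thesis using that by simp
qed

lemma below_end_any:
  assumes "x \<in> X"
  obtains e where "e \<in> ends" "x \<preceq> e"
proof (cases "x = t")
  case True
  obtain e where "e \<in> ends" by (rule exists_end)
  then show thesis using that base_below[OF ends_X] True by blast
next
  case False
  show thesis using below_end[OF assms False] that by metis
qed

section \<open>Homeomorphisms of a fan\<close>

definition autohom :: "('a \<Rightarrow> 'a) \<Rightarrow> bool" where
  "autohom f \<longleftrightarrow> (\<exists>g. homeomorphism X X f g)"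

lemma autohom_X: "autohom f \<Longrightarrow> x \<in> X \<Longrightarrow> f x \<in> X"
  unfolding autohom_def homeomorphism_def by blast

lemma autohom_continuous: "autohom f \<Longrightarrow> continuous_on X f"
  unfolding autohom_def homeomorphism_def by blast

lemma autohom_inj: "autohom f \<Longrightarrow> inj_on f X"
  unfolding autohom_def homeomorphism_def by (metis inj_on_inverseI)

lemma autohom_id: "autohom (\<lambda>x. x)"
  unfolding autohom_def using homeomorphism_ident by blast

lemma autohom_comp: "autohom f \<Longrightarrow> autohom h \<Longrightarrow> autohom (h \<circ> f)"
  unfolding autohom_def using homeomorphism_compose by blast

lemma autohom_inverse:
  assumes "autohom f"
  obtains g where "autohom g" "\<And>x. x \<in> X \<Longrightarrow> g (f x) = x" "\<And>x. x \<in> X \<Longrightarrow> f (g x) = x"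
proof -
  obtain g where g: "homeomorphism X X f g" using assms unfolding autohom_def by blast
  show thesis
  proof
    show "autohom g" using homeomorphism_symD[OF g] unfolding autohom_def by blast
    show "g (f x) = x" "f (g x) = x" if "x \<in> X" for x
      using g that unfolding homeomorphism_def by blast+
  qed
qed

lemma autohom_limit:
  assumes "autohom f" "\<And>n. s n \<in> X" "s \<longlonglongrightarrow> x"
  shows "(\<lambda>n. f (s n)) \<longlonglongrightarrow> f x"
proof -
  have "(f \<circ> s) \<longlonglongrightarrow> f x"
    using autohom_continuous[OF assms(1)] assms(2,3) limit_X[OF assms(2,3)]
    unfolding continuous_on_sequentially by blast
  then show ?thesis by (simp add: o_def)
qed

lemma autohom_classical_order:
  assumes f: "autohom f"
  shows "classical_order X p \<le> classical_order X (f p)"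
  unfolding classical_order_def[of X p]
proof (rule SUP_least)
  fix \<A> assume "\<A> \<in> {\<A>. finite \<A> \<and> arc_star X p \<A>}"
  then have A: "finite \<A>" "arc_star X p \<A>" by auto
  have sub: "A \<subseteq> X" if "A \<in> \<A>" for A
    using A(2) that arc_joining_continuum(2) unfolding arc_star_def by blast
  have inj: "inj_on f (\<Union>\<A>)"
    using autohom_inj[OF f] sub by (meson Union_least inj_on_subset)
  have "arc_star X (f p) ((`) f ` \<A>)"
    unfolding arc_star_def
  proof (intro conjI ballI)
    fix B assume "B \<in> (`) f ` \<A>"
    then obtain A q where Aq: "A \<in> \<A>" "B = f ` A" "arc_joining X p q A"
      using A(2) unfolding arc_star_def by blast
    then obtain g where g: "arc g" "pathstart g = p" "pathfinish g = q" "path_image g = A" "A \<subseteq> X"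
      unfolding arc_joining_def by metis
    have "arc (f \<circ> g)"
      using g(1,4,5) autohom_continuous[OF f] autohom_inj[OF f]
      unfolding arc_def path_image_def
      by (metis comp_inj_on continuous_on_subset inj_on_subset path_continuous_image path_image_def)
    moreover have "f ` A \<subseteq> X" using g(5) autohom_X[OF f] by blast
    ultimately have "arc_joining X (f p) (f q) B"
      unfolding arc_joining_def using g Aq(2)
      by (intro exI[of _ "f \<circ> g"]) (simp add: pathstart_compose pathfinish_compose path_image_compose)
    then show "\<exists>q. arc_joining X (f p) q B" by blast
  next
    show "pairwise (\<lambda>A B. A \<inter> B = {f p}) ((`) f ` \<A>)"
      unfolding pairwise_def
    proof (intro ballI impI)
      fix B C assume "B \<in> (`) f ` \<A>" "C \<in> (`) f ` \<A>" "B \<noteq> C"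
      then obtain A D where AD: "A \<in> \<A>" "D \<in> \<A>" "A \<noteq> D" "B = f ` A" "C = f ` D" by blast
      then have "A \<inter> D = {p}" using A(2) unfolding arc_star_def pairwise_def by blast
      moreover have "f ` (A \<inter> D) = B \<inter> C"
        using inj_on_image_Int[OF autohom_inj[OF f] sub[OF AD(1)] sub[OF AD(2)]] AD(4,5) by simp
      ultimately show "B \<inter> C = {f p}" by auto
    qed
  qed
  then have "enat (card ((`) f ` \<A>)) \<le> classical_order X (f p)"
    using A(1) by (intro classical_order_ge_card) auto
  then show "enat (card \<A>) \<le> classical_order X (f p)"
    using card_image[OF inj_on_image[OF inj]] by simp
qed

lemma autohom_top: "autohom f \<Longrightarrow> f t = t"
  using autohom_classical_order[of f t] order_top autohom_X[OF _ base] ramification_iff_top[of "f t"]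
  by (auto simp: ramification_point_def)

text \<open>The inverse carries the arc between the images to a continuum through \<open>p\<close>
  and \<open>q\<close>, which contains \<open>seg p q\<close> by minimality.\<close>

lemma autohom_seg:
  assumes f: "autohom f" and pq: "p \<in> X" "q \<in> X" and c: "c \<in> seg p q"
  shows "f c \<in> seg (f p) (f q)"
proof -
  obtain g where g: "autohom g" "\<And>x. x \<in> X \<Longrightarrow> g (f x) = x" "\<And>x. x \<in> X \<Longrightarrow> f (g x) = x"
    using autohom_inverse[OF f] by blast
  let ?S = "seg (f p) (f q)"
  have fX: "f p \<in> X" "f q \<in> X" using autohom_X[OF f] pq by auto
  have SX: "?S \<subseteq> X" using seg_subset[OF fX] .
  have cont: "continuous_on ?S g" using continuous_on_subset[OF autohom_continuous[OF g(1)] SX] .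
  have "continuum (g ` ?S)"
    using compact_continuous_image[OF cont seg_compact[OF fX]]
      connected_continuous_image[OF cont seg_connected[OF fX]] seg_ends(1)[OF fX]
    by (auto simp: continuum_def)
  moreover have "g ` ?S \<subseteq> X" using SX autohom_X[OF g(1)] by blast
  moreover have "p \<in> g ` ?S" "q \<in> g ` ?S"
    using seg_ends[OF fX] g(2) pq by (metis image_eqI)+
  ultimately have "c \<in> g ` ?S" using seg_minimal c by blast
  then show ?thesis using g(3) SX by auto
qed

lemma autohom_below: "autohom f \<Longrightarrow> x \<preceq> y \<Longrightarrow> f x \<preceq> f y"
  using autohom_seg[of f t y x] autohom_top[of f] base autohom_X[of f y] by (simp add: below_def)

lemma autohom_limit_below:
  assumes f: "autohom f" and "p \<sqsubseteq> y"
  shows "f p \<sqsubseteq> f y"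
proof -
  obtain P Y where PY: "\<And>n. P n \<preceq> Y n" "P \<longlonglongrightarrow> p" "Y \<longlonglongrightarrow> y"
    using limit_belowE[OF assms(2)] by metis
  show ?thesis
    using limit_belowI[OF autohom_below[OF f PY(1)] autohom_limit[OF f below_X(1)[OF PY(1)] PY(2)]
        autohom_limit[OF f below_X(2)[OF PY(1)] PY(3)]] .
qed

lemma autohom_ends:
  assumes f: "autohom f" and e: "e \<in> ends"
  shows "f e \<in> ends"
proof -
  obtain g where g: "autohom g" "\<And>x. x \<in> X \<Longrightarrow> g (f x) = x" "\<And>x. x \<in> X \<Longrightarrow> f (g x) = x"
    using autohom_inverse[OF f] by blast
  have "f e \<noteq> t" using g(2)[OF ends_X[OF e]] autohom_top[OF g(1)] ends_ne_top[OF e] by metis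
  moreover have "y = f e" if "f e \<preceq> y" for y
  proof -
    have "e \<preceq> g y" using autohom_below[OF g(1) that] g(2)[OF ends_X[OF e]] by simp
    then have "g y = e" using ends_maximal[OF e] by blast
    then show ?thesis using g(3) below_X(2)[OF that] by metis
  qed
  ultimately show ?thesis using autohom_X[OF f ends_X[OF e]] by (auto simp: ends_def)
qed

lemma autohom_smooth_points_iff:
  assumes f: "autohom f" and x: "x \<in> X"
  shows "f x \<in> smooth_points \<longleftrightarrow> x \<in> smooth_points"
proof -
  have 1: "h y \<in> smooth_points" if h: "autohom h" and y: "y \<in> smooth_points" for h y
  proof -
    obtain g where g: "autohom g" "\<And>x. x \<in> X \<Longrightarrow> g (h x) = x" "\<And>x. x \<in> X \<Longrightarrow> h (g x) = x"
      using autohom_inverse[OF h] by blast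
    have yX: "y \<in> X" using y by (simp add: smooth_points_def)
    have "p \<preceq> h y" if p: "p \<sqsubseteq> h y" for p
    proof -
      have "g p \<sqsubseteq> y" using autohom_limit_below[OF g(1) p] g(2)[OF yX] by simp
      then have "g p \<preceq> y" using y by (simp add: smooth_points_def)
      then show ?thesis using autohom_below[OF h] g(3)[OF limit_below_X(1)[OF p]] by metis
    qed
    then show ?thesis using autohom_X[OF h yX] by (simp add: smooth_points_def)
  qed
  obtain g where g: "autohom g" "\<And>x. x \<in> X \<Longrightarrow> g (f x) = x" "\<And>x. x \<in> X \<Longrightarrow> f (g x) = x"
    using autohom_inverse[OF f] by blast
  show ?thesis using 1[OF f, of x] 1[OF g(1), of "f x"] g(2)[OF x] by auto
qed

lemma same_orbit_iff: "(x, y) \<in> same_orbit X \<longleftrightarrow> x \<in> X \<and> (\<exists>f. autohom f \<and> y = f x)"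
  unfolding same_orbit_def autohom_def by blast

end

lemma inequivalent_card_le:
  assumes "fractionally_homogeneous n X" "P \<subseteq> X"
    and ineq: "\<And>x y. x \<in> P \<Longrightarrow> y \<in> P \<Longrightarrow> x \<noteq> y \<Longrightarrow> (x, y) \<notin> same_orbit X"
  shows "card P \<le> n"
proof -
  let ?q = "\<lambda>x. same_orbit X `` {x}"
  have refl: "(x, x) \<in> same_orbit X" if "x \<in> X" for x
    unfolding same_orbit_def using that homeomorphism_ident[of X] by blast
  have "inj_on ?q P"
  proof (rule inj_onI)
    fix x y assume xy: "x \<in> P" "y \<in> P" "?q x = ?q y"
    have "y \<in> ?q x" using xy refl assms(2) by blast
    then show "x = y" using ineq xy by blast
  qed
  moreover have "?q ` P \<subseteq> X // same_orbit X"
    using assms(2) by (auto simp: quotient_def)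
  ultimately show ?thesis
    using card_inj_on_le[of ?q P "X // same_orbit X"] assms(1)
    unfolding fractionally_homogeneous_def by simp
qed

section \<open>Density of the points of smoothness\<close>

text \<open>By lower semicontinuity of the arcs, a point is smooth unless it lies on the boundary of one
  of countably many open sets.\<close>

lemma (in pointed_dendroid) smooth_points_dense:
  assumes W: "open W" "W \<inter> X \<noteq> {}"
  shows "W \<inter> smooth_points \<noteq> {}"
proof -
  obtain D where D: "countable D" "\<And>y r. y \<in> X \<Longrightarrow> r > 0 \<Longrightarrow> \<exists>d\<in>D. dist d y < r"
    using compact_countable_dense_subset[OF compact_X] by metis
  define up where "up B = {x \<in> X. seg t x \<inter> B \<noteq> {}}" for B
  \<comment> \<open>\<open>H B\<close> is the complement in \<open>X\<close> of the boundary of the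
    relatively open set \<open>up B\<close>, hence open and dense.\<close>
  define H where "H B = up B \<union> (X - closure (up B))" for B
  define \<B> where "\<B> = (\<lambda>(d, k). ball d (inverse (real (Suc k)))) ` (D \<times> UNIV)"
  have oB: "open B" if "B \<in> \<B>" for B using that by (auto simp: \<B>_def)
  have up_open: "openin (top_of_set X) (up B)" if B: "open B" for B
  proof (rule openin_subset_sequentially)
    fix x s assume h: "x \<in> up B" "\<And>n::nat. s n \<in> X" "s \<longlonglongrightarrow> x"
    then obtain c where c: "x \<in> X" "c \<in> seg t x" "c \<in> B" by (auto simp: up_def)
    have "eventually (\<lambda>n. seg t (s n) \<inter> B \<noteq> {}) sequentially"
      by (rule seg_lower_semicontinuous[OF base c(1,2) B c(3) _ h(2) _ h(3)]) (use base in auto)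
    then show "eventually (\<lambda>n. s n \<in> up B) sequentially" using h(2) by (simp add: up_def)
  qed (auto simp: up_def)
  have H_open: "openin (top_of_set X) (H B)" if "open B" for B
    unfolding H_def
  proof (rule openin_Un[OF up_open[OF that]])
    have "X - closure (up B) = X \<inter> - closure (up B)" by blast
    then show "openin (top_of_set X) (X - closure (up B))"
      by (metis closed_closure openin_open_Int open_Compl)
  qed
  have H_dense: "G \<inter> H B \<noteq> {}" if G: "open G" "G \<inter> X \<noteq> {}" for G B
  proof (cases "G \<inter> up B = {}")
    case True
    then have "G \<inter> closure (up B) = {}" using open_Int_closure_eq_empty[OF G(1)] by blast
    then show ?thesis using G(2) unfolding H_def by blast
  qed (auto simp: H_def)
  obtain x where x: "x \<in> W" "x \<in> X" "\<And>S. S \<in> H ` \<B> \<Longrightarrow> x \<in> S"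
  proof (rule compact_Baire_dense_open[OF compact_X W, of "H ` \<B>"])
    show "countable (H ` \<B>)" using D(1) by (simp add: \<B>_def)
    show "openin (top_of_set X) S" if "S \<in> H ` \<B>" for S using that H_open oB by blast
    show "G \<inter> S \<noteq> {}" if "S \<in> H ` \<B>" "open G" "G \<subseteq> W" "G \<inter> X \<noteq> {}" for S G
      using that H_dense by blast
  qed blast
  have "p \<preceq> x" if p: "p \<sqsubseteq> x" for p
  proof (rule ccontr)
    assume "\<not> p \<preceq> x"
    then have "p \<in> - seg t x" using x(2) by (simp add: below_def)
    moreover have "open (- seg t x)" using seg_closed[OF base x(2)] by auto
    ultimately obtain e where e: "e > 0" "ball p e \<subseteq> - seg t x"
      using open_contains_ball by blast
    obtain k where k: "inverse (real (Suc k)) < e / 2" using reals_Archimedean[of "e / 2"] e by auto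
    obtain d where d: "d \<in> D" "dist d p < inverse (real (Suc k))"
      using D(2)[OF limit_below_X(1)[OF p], of "inverse (real (Suc k))"] by auto
    let ?B = "ball d (inverse (real (Suc k)))"
    have "?B \<subseteq> ball p e"
    proof
      fix y assume "y \<in> ?B"
      then have "dist d y < e / 2" "dist d p < e / 2" using d(2) k by auto
      moreover have "dist p y \<le> dist d p + dist d y" by metric
      ultimately show "y \<in> ball p e" by simp
    qed
    \<comment> \<open>The arc to \<open>x\<close> misses this ball, while the arcs to the points
      \<open>Y n\<close> tending to \<open>x\<close> eventually meet it. So \<open>x\<close> is on
      the boundary that \<open>H\<close> excludes.\<close>
    then have "x \<notin> up ?B" using e(2) by (auto simp: up_def)
    moreover have "?B \<in> \<B>" using d(1) by (auto simp: \<B>_def)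
    ultimately have nc: "x \<notin> closure (up ?B)" using x(3) by (auto simp: H_def)
    obtain P Y where PY: "\<And>n. P n \<preceq> Y n" "P \<longlonglongrightarrow> p" "Y \<longlonglongrightarrow> x"
      using limit_belowE[OF p] by metis
    have "eventually (\<lambda>n. P n \<in> ?B) sequentially"
      by (rule topological_tendstoD[OF PY(2)]) (use d(2) in auto)
    moreover have "eventually (\<lambda>n. Y n \<in> - closure (up ?B)) sequentially"
      by (rule topological_tendstoD[OF PY(3)]) (use nc in auto)
    ultimately have "eventually (\<lambda>n. P n \<in> ?B \<and> Y n \<in> - closure (up ?B)) sequentially"
      by (rule eventually_conj)
    then obtain n where n: "P n \<in> ?B" "Y n \<notin> closure (up ?B)"
      using eventually_happens'[OF sequentially_bot] by blast
    have "Y n \<in> up ?B" using n(1) PY(1)[of n] by (auto simp: up_def below_def)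
    then show False using n(2) closure_subset[of "up ?B"] by blast
  qed
  then have "x \<in> smooth_points" using x(2) by (simp add: smooth_points_def)
  then show ?thesis using x(1) by blast
qed

section \<open>Fans with at most four orbits\<close>

locale four_orbit_fan = fan_space +
  assumes four: "fractionally_homogeneous 4 X"
begin

definition equivalent :: "'a \<Rightarrow> 'a \<Rightarrow> bool" where
  "equivalent x y \<longleftrightarrow> (\<exists>f. autohom f \<and> f x = y)"

lemma equivalentE:
  assumes "equivalent x y"
  obtains f where "autohom f" "f x = y"
  using assms unfolding equivalent_def by blast

lemma equivalent_sym:
  assumes "x \<in> X" "equivalent x y"
  shows "equivalent y x"
proof -
  obtain f where f: "autohom f" "f x = y" by (rule equivalentE[OF assms(2)])
  obtain g where g: "autohom g" "\<And>x. x \<in> X \<Longrightarrow> g (f x) = x"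
    using autohom_inverse[OF f(1)] by metis
  have "g y = x" using g(2)[OF assms(1)] f(2) by simp
  then show ?thesis using g(1) unfolding equivalent_def by blast
qed

text \<open>The only access to the orbit count. In a list each pair has to be refuted in one
  direction only; the lists used later put \<open>t\<close> and the ends first, so that invariance
  of these points settles most pairs.\<close>

lemma five_points:
  assumes "set xs \<subseteq> X" "length xs = 5" "sorted_wrt (\<lambda>x y. \<not> equivalent x y) xs"
  shows False
proof -
  have less: "\<not> equivalent (xs ! i) (xs ! j)" if "i < j" "j < length xs" for i j
    using assms(3) that unfolding sorted_wrt_iff_nth_less by blast
  have ineq: "\<not> equivalent (xs ! i) (xs ! j)" if ij: "i < length xs" "j < length xs" "i \<noteq> j" for i j
  proof (cases "i < j")
    case True
    then show ?thesis using less ij(2) by blast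
  next
    case False
    then have "\<not> equivalent (xs ! j) (xs ! i)" using less ij by simp
    moreover have "xs ! i \<in> X" using assms(1) nth_mem[OF ij(1)] by blast
    ultimately show ?thesis using equivalent_sym by blast
  qed
  have refl: "equivalent x x" for x unfolding equivalent_def using autohom_id by blast
  have "distinct xs"
    unfolding distinct_conv_nth using ineq refl by metis
  then have "card (set xs) = 5" using assms(2) distinct_card by metis
  moreover have "card (set xs) \<le> 4"
  proof (rule inequivalent_card_le[OF four assms(1)])
    fix x y assume xy: "x \<in> set xs" "y \<in> set xs" "x \<noteq> y"
    obtain i j where ij: "i < length xs" "x = xs ! i" "j < length xs" "y = xs ! j"
      using xy(1,2) unfolding in_set_conv_nth by metis
    then have "i \<noteq> j" using xy(3) by blast
    then have "\<not> equivalent x y" using ineq ij by simp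
    then show "(x, y) \<notin> same_orbit X" unfolding same_orbit_iff equivalent_def by blast
  qed
  ultimately show False by simp
qed

lemma not_equivalent_top: "x \<noteq> t \<Longrightarrow> \<not> equivalent t x"
  by (auto elim!: equivalentE simp: autohom_top)

lemma not_equivalent_end: "e \<in> ends \<Longrightarrow> x \<notin> ends \<Longrightarrow> \<not> equivalent e x"
  by (auto elim!: equivalentE dest: autohom_ends)

lemma not_end_of_below: "x \<preceq> e \<Longrightarrow> x \<noteq> e \<Longrightarrow> x \<notin> ends"
  using ends_maximal[of x e] by auto

text \<open>The orbit of an end is determined by the orbit of any inner point of its leg.\<close>

lemma ends_equivalent:
  assumes e: "e \<in> ends" and e': "e' \<in> ends"
  shows "equivalent e e'"
proof (rule ccontr)
  assume ne: "\<not> equivalent e e'"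
  obtain x where x: "t \<preceq> x" "x \<preceq> e" "x \<noteq> t" "x \<noteq> e"
    using inner_point[OF base_below[OF ends_X[OF e]] ends_ne_top[OF e, symmetric]] by blast
  obtain x' where x': "t \<preceq> x'" "x' \<preceq> e'" "x' \<noteq> t" "x' \<noteq> e'"
    using inner_point[OF base_below[OF ends_X[OF e']] ends_ne_top[OF e', symmetric]] by blast
  have "\<not> equivalent x x'"
  proof
    assume "equivalent x x'"
    then obtain f where f: "autohom f" "f x = x'" by (rule equivalentE)
    have "x' \<preceq> f e" using autohom_below[OF f(1) x(2)] f(2) by simp
    then have "f e = e'"
      using end_unique[OF x'(3) autohom_ends[OF f(1) e] e' _ x'(2)] by blast
    then show False using ne f(1) unfolding equivalent_def by blast
  qed
  moreover have "x \<notin> ends" "x' \<notin> ends" using x x' not_end_of_below by blast+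
  moreover have "set [t, e, e', x, x'] \<subseteq> X"
    using base ends_X[OF e] ends_X[OF e'] below_X(1)[OF x(2)] below_X(1)[OF x'(2)] by simp
  ultimately show False
    using five_points[of "[t, e, e', x, x']"] ne not_equivalent_top[OF ends_ne_top[OF e]]
      not_equivalent_top[OF ends_ne_top[OF e']] not_equivalent_top[OF x(3)] not_equivalent_top[OF x'(3)]
      not_equivalent_end[OF e] not_equivalent_end[OF e'] by simp
qed

lemma leg_stabilizer:
  assumes "autohom f" "e \<in> ends" "u \<preceq> e" "f u \<preceq> e" "f u \<noteq> t"
  shows "f e = e"
  using end_unique[OF assms(5) autohom_ends[OF assms(1,2)] assms(2) autohom_below[OF assms(1,3)] assms(4)] .

text \<open>A fixed point would split the inner points of the leg into three orbits.\<close>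

lemma no_fixed_inner_point:
  assumes e: "e \<in> ends" and m: "m \<preceq> e" "m \<noteq> t" "m \<noteq> e"
  obtains f where "autohom f" "f e = e" "f m \<noteq> m"
proof (rule ccontr)
  assume "\<not> thesis"
  then have fixed: "\<And>f. autohom f \<Longrightarrow> f e = e \<Longrightarrow> f m = m" using that by blast
  have mX: "m \<in> X" using below_X(1)[OF m(1)] .
  obtain x where x: "t \<preceq> x" "x \<preceq> m" "x \<noteq> t" "x \<noteq> m"
    using inner_point[OF base_below[OF mX] m(2)[symmetric]] by blast
  obtain y where y: "m \<preceq> y" "y \<preceq> e" "y \<noteq> m" "y \<noteq> e"
    using inner_point[OF m(1,3)] by blast
  have xe: "x \<preceq> e" using below_trans x(2) m(1) by blast
  have yt: "y \<noteq> t" using y(1) m(2) base_below[OF mX] below_antisym by blast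
  have 1: "\<not> equivalent x m"
  proof
    assume "equivalent x m"
    then obtain f where f: "autohom f" "f x = m" by (rule equivalentE)
    then have "f e = e" using leg_stabilizer[OF f(1) e xe] m by simp
    then have "f m = f x" using fixed f by simp
    then show False using inj_onD[OF autohom_inj[OF f(1)]] mX below_X(1)[OF xe] x(4) by blast
  qed
  have 2: "\<not> equivalent m y"
  proof
    assume "equivalent m y"
    then obtain f where f: "autohom f" "f m = y" by (rule equivalentE)
    then have "f e = e" using leg_stabilizer[OF f(1) e m(1)] y yt by simp
    then show False using fixed f y(3) by blast
  qed
  have 3: "\<not> equivalent x y"
  proof
    assume "equivalent x y"
    then obtain f where f: "autohom f" "f x = y" by (rule equivalentE)
    then have "f e = e" using leg_stabilizer[OF f(1) e xe] y yt by simp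
    then have "f m = m" using fixed f(1) by blast
    then have "y \<preceq> m" using autohom_below[OF f(1) x(2)] f(2) by simp
    then show False using y(1,3) below_antisym by blast
  qed
  have ne: "x \<notin> ends" "m \<notin> ends" "y \<notin> ends"
    using not_end_of_below x(2,4) m(1,3) y(2,4) by blast+
  have "set [t, e, x, m, y] \<subseteq> X"
    using base ends_X[OF e] below_X(1)[OF xe] mX below_X(1)[OF y(2)] by simp
  then show False
    using five_points[of "[t, e, x, m, y]"] 1 2 3 not_equivalent_top[OF ends_ne_top[OF e]]
      not_equivalent_top[OF x(3)] not_equivalent_top[OF m(2)] not_equivalent_top[OF yt]
      not_equivalent_end[OF e ne(1)] not_equivalent_end[OF e ne(2)] not_equivalent_end[OF e ne(3)]
    by simp
qed

text \<open>A homeomorphism in the stabilizer of \<open>e\<close> and its inverse can both only move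
  the last point of \<open>J\<close> down, so they fix it. It is then \<open>t\<close> or
  \<open>e\<close>, and \<open>c0\<close> excludes \<open>t\<close>.\<close>

lemma invariant_closed_max:
  assumes e: "e \<in> ends" and J: "closed J" "\<And>c. c \<in> J \<Longrightarrow> c \<preceq> e" "c0 \<in> J" "c0 \<noteq> t"
    and inv: "\<And>f c. autohom f \<Longrightarrow> f e = e \<Longrightarrow> c \<in> J \<Longrightarrow> f c \<in> J"
  shows "e \<in> J"
proof -
  have "J \<subseteq> seg t e" using J(2) by (auto simp: below_def)
  then obtain m where m: "m \<in> J" "J \<subseteq> seg t m"
    using closed_subset_seg_max[OF base ends_X[OF e] _ J(1)] J(3) by blast
  have mX: "m \<in> X" using below_X(1)[OF J(2)[OF m(1)]] .
  have max: "c \<preceq> m" if "c \<in> J" for c using m(2) that mX by (auto simp: below_def)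
  have mt: "m \<noteq> t" using m(2) J(3,4) by auto
  have "m = e"
  proof (rule ccontr)
    assume "m \<noteq> e"
    then obtain f where f: "autohom f" "f e = e" "f m \<noteq> m"
      using no_fixed_inner_point[OF e J(2)[OF m(1)] mt] by blast
    obtain g where g: "autohom g" "\<And>x. x \<in> X \<Longrightarrow> g (f x) = x" "\<And>x. x \<in> X \<Longrightarrow> f (g x) = x"
      using autohom_inverse[OF f(1)] by blast
    have "g e = e" using g(2)[OF ends_X[OF e]] f(2) by simp
    then have "g m \<preceq> m" using max inv[OF g(1) _ m(1)] by blast
    then have "m \<preceq> f m" using autohom_below[OF f(1)] g(3)[OF mX] by metis
    moreover have "f m \<preceq> m" using max inv[OF f(1,2) m(1)] by blast
    ultimately show False using f(3) below_antisym by blast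
  qed
  then show ?thesis using m(1) by simp
qed

text \<open>The same argument with the leg traversed from \<open>e\<close>, so that the last point
  in that direction is the least in the order.\<close>

lemma invariant_closed_min:
  assumes e: "e \<in> ends" and J: "closed J" "\<And>c. c \<in> J \<Longrightarrow> c \<preceq> e" "c0 \<in> J" "c0 \<noteq> e"
    and inv: "\<And>f c. autohom f \<Longrightarrow> f e = e \<Longrightarrow> c \<in> J \<Longrightarrow> f c \<in> J"
  shows "t \<in> J"
proof -
  have "J \<subseteq> seg e t" using J(2) seg_sym[OF base ends_X[OF e]] by (auto simp: below_def)
  then obtain m where m: "m \<in> J" "J \<subseteq> seg e m"
    using closed_subset_seg_max[OF ends_X[OF e] base _ J(1)] J(3) by blast
  have mX: "m \<in> X" using below_X(1)[OF J(2)[OF m(1)]] .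
  have min: "m \<preceq> c" if "c \<in> J" for c
    using m(2) that seg_sym[OF mX ends_X[OF e]] mem_seg_iff_between[OF J(2)[OF m(1)], of c] by blast
  have me: "m \<noteq> e" using m(2) J(3,4) by auto
  have "m = t"
  proof (rule ccontr)
    assume "m \<noteq> t"
    then obtain f where f: "autohom f" "f e = e" "f m \<noteq> m"
      using no_fixed_inner_point[OF e J(2)[OF m(1)] _ me] by blast
    obtain g where g: "autohom g" "\<And>x. x \<in> X \<Longrightarrow> g (f x) = x" "\<And>x. x \<in> X \<Longrightarrow> f (g x) = x"
      using autohom_inverse[OF f(1)] by blast
    have "g e = e" using g(2)[OF ends_X[OF e]] f(2) by simp
    then have "m \<preceq> g m" using min inv[OF g(1) _ m(1)] by blast
    then have "f m \<preceq> m" using autohom_below[OF f(1)] g(3)[OF mX] by metis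
    moreover have "m \<preceq> f m" using min inv[OF f(1,2) m(1)] by blast
    ultimately show False using f(3) below_antisym by blast
  qed
  then show ?thesis using m(1) by simp
qed

section \<open>Limits of arcs at the ends and at the top\<close>

lemma end_limit_below:
  assumes e: "e \<in> ends" and y: "e \<sqsubseteq> y"
  shows "y = e"
proof (rule ccontr)
  assume ye: "y \<noteq> e"
  \<comment> \<open>The arc from \<open>e\<close> to \<open>y\<close> starts along the leg of
    \<open>e\<close>. This supplies a point of the invariant set other than
    \<open>e\<close>.\<close>
  obtain c where c: "c \<preceq> e" "c \<noteq> e" "seg c e \<subseteq> seg e y"
    using seg_from_end[OF e limit_below_X(2)[OF y] ye] by blast
  have "c \<in> seg e y" using c(3) seg_ends(1)[OF below_X[OF c(1)]] by blast
  then have "e \<sqsubseteq> c" using limit_below_seg(1)[OF y] by blast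
  then have "t \<in> {c. c \<preceq> e} \<inter> {c. e \<sqsubseteq> c}"
  proof (intro invariant_closed_min[OF e])
    show "closed ({c. c \<preceq> e} \<inter> {c. e \<sqsubseteq> c})"
      using closed_below[OF ends_X[OF e]] closed_limit_below(2) by blast
    show "f d \<in> {c. c \<preceq> e} \<inter> {c. e \<sqsubseteq> c}"
      if h: "autohom f" "f e = e" "d \<in> {c. c \<preceq> e} \<inter> {c. e \<sqsubseteq> c}" for f d
      using h(3) autohom_below[OF h(1), of d e] autohom_limit_below[OF h(1), of e d] h(2) by simp
  qed (use c in auto)
  then have et: "e \<sqsubseteq> t" by blast
  \<comment> \<open>Equivalence of the ends carries the relation to every other end, and the points
    below an end inherit it.\<close>
  have "p \<sqsubseteq> t" if p: "p \<in> X" for p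
  proof (cases "p = t")
    case True then show ?thesis using below_imp_limit_below[OF below_refl[OF base]] by simp
  next
    case False
    obtain e' where e': "e' \<in> ends" "p \<preceq> e'" by (rule below_end[OF p False])
    obtain f where f: "autohom f" "f e = e'" by (rule equivalentE[OF ends_equivalent[OF e e'(1)]])
    have "e' \<sqsubseteq> t" using autohom_limit_below[OF f(1) et] f(2) autohom_top[OF f(1)] by simp
    then show ?thesis using below_limit_below_trans[OF e'(2)] by blast
  qed
  then show False using limit_below_base_trivial not_singleton by blast
qed

lemma limit_below_top:
  assumes p: "p \<sqsubseteq> t"
  shows "p = t"
proof (rule ccontr)
  assume pt: "p \<noteq> t"
  obtain e where e: "e \<in> ends" "p \<preceq> e" by (rule below_end[OF limit_below_X(1)[OF p] pt])
  have "e \<in> {c. c \<preceq> e} \<inter> {c. c \<sqsubseteq> t}"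
  proof (rule invariant_closed_max[OF e(1), of _ p])
    show "closed ({c. c \<preceq> e} \<inter> {c. c \<sqsubseteq> t})"
      using closed_below[OF ends_X[OF e(1)]] closed_limit_below(1) by blast
    show "f d \<in> {c. c \<preceq> e} \<inter> {c. c \<sqsubseteq> t}"
      if h: "autohom f" "f e = e" "d \<in> {c. c \<preceq> e} \<inter> {c. c \<sqsubseteq> t}" for f d
      using h(3) autohom_below[OF h(1), of d e] autohom_limit_below[OF h(1), of d t]
        autohom_top[OF h(1)] h(2) by simp
  qed (use e p pt in auto)
  then have "e \<sqsubseteq> t" by blast
  then show False using end_limit_below[OF e(1)] ends_ne_top[OF e(1)] by blast
qed

lemma top_smooth: "t \<in> smooth_points"
  using limit_below_top below_refl[OF base] base by (auto simp: smooth_points_def)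

text \<open>For incomparable points the arc between them contains \<open>t\<close>, whence
  \<open>p \<sqsubseteq> t\<close> and \<open>p = t\<close>, which is below everything. So a failure
  of smoothness at a point happens inside its own leg.\<close>

lemma limit_below_comparable:
  assumes "p \<sqsubseteq> x"
  shows "p \<preceq> x \<or> x \<preceq> p"
proof (rule ccontr)
  assume inc: "\<not> ?thesis"
  have X: "p \<in> X" "x \<in> X" using limit_below_X[OF assms] by auto
  have "t \<in> seg p x" using top_in_seg_incomparable[OF X] inc by blast
  then have "p \<sqsubseteq> t" using limit_below_seg(1)[OF assms] by blast
  then show False using limit_below_top base_below[OF X(2)] inc by blast
qed

lemma ends_smooth:
  assumes e: "e \<in> ends"
  shows "e \<in> smooth_points"
proof -
  have "p \<preceq> e" if "p \<sqsubseteq> e" for p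
    using limit_below_comparable[OF that] ends_maximal[OF e, of p] below_refl[OF ends_X[OF e]] by blast
  then show ?thesis using ends_X[OF e] by (simp add: smooth_points_def)
qed

text \<open>The set removed is the closure of the union of all arcs from \<open>t\<close> to points
  outside the given neighbourhood, hence connected. If \<open>e\<close> were in it, endpoints of
  such arcs would accumulate at some \<open>l\<close> with \<open>e \<sqsubseteq> l\<close> and
  \<open>l \<noteq> e\<close>.\<close>

lemma colocally_connected_at_end:
  assumes e: "e \<in> ends"
  shows "colocally_connected_at X e"
  unfolding colocally_connected_at_def neighbourhood_base_at_def
proof (intro allI impI)
  fix W assume "openin (top_of_set X) W \<and> e \<in> W"
  then obtain W' where W': "open W'" "W = X \<inter> W'" "e \<in> W'" by (auto simp: openin_open)
  define M where "M = (\<Union>y\<in>X - W'. seg t y)"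
  define V where "V = X - closure M"
  have MX: "closure M \<subseteq> X"
    using seg_subset[OF base] compact_imp_closed[OF compact_X] unfolding M_def
    by (intro closure_minimal) auto
  have sub: "X - W' \<subseteq> M" using seg_ends(2)[OF base] by (auto simp: M_def)
  have "connected M"
    unfolding M_def
  proof (rule connected_Union)
    show "connected S" if "S \<in> seg t ` (X - W')" for S using that seg_connected[OF base] by auto
    have "t \<in> \<Inter> (seg t ` (X - W'))" using seg_ends(1)[OF base] by auto
    then show "\<Inter> (seg t ` (X - W')) \<noteq> {}" by blast
  qed
  then have "connected (closure M)" by (rule connected_imp_connected_closure)
  moreover have "X - V = closure M" using MX by (auto simp: V_def)
  moreover have "e \<notin> closure M"
  proof
    assume "e \<in> closure M"
    then obtain s where s: "\<forall>n. s n \<in> M" "s \<longlonglongrightarrow> e" unfolding closure_sequential by blast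
    then have "\<forall>n. \<exists>y. y \<in> X - W' \<and> s n \<in> seg t y" by (auto simp: M_def)
    from choice[OF this] obtain y where y: "\<forall>n. y n \<in> X - W' \<and> s n \<in> seg t (y n)" by blast
    have "compact (X - W')" using compact_X W'(1) by (simp add: compact_diff)
    then obtain l r where l: "l \<in> X - W'" "strict_mono (r :: nat \<Rightarrow> nat)" "(y \<circ> r) \<longlonglongrightarrow> l"
      using seq_compactE[OF compact_imp_seq_compact, of "X - W'" y] y by blast
    have "e \<sqsubseteq> l"
    proof (rule limit_belowI[of "s \<circ> r" "y \<circ> r"])
      show "(s \<circ> r) n \<preceq> (y \<circ> r) n" for n using y by (auto simp: below_def)
    qed (use l(3) LIMSEQ_subseq_LIMSEQ[OF s(2) l(2)] in auto)
    then show False using end_limit_below[OF e] l(1) W'(3) by blast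
  qed
  then have "e \<in> V" using ends_X[OF e] by (simp add: V_def)
  moreover have "openin (top_of_set X) V"
  proof -
    have "V = X \<inter> - closure M" by (auto simp: V_def)
    then show ?thesis by (metis closed_closure openin_open_Int open_Compl)
  qed
  moreover have "V \<subseteq> W" using sub closure_subset[of M] W'(2) by (auto simp: V_def)
  ultimately show "\<exists>U V. openin (top_of_set X) U \<and> connected (X - V) \<and> e \<in> U \<and> U \<subseteq> V \<and> V \<subseteq> W"
    by (intro exI[of _ V]) simp
qed

section \<open>Folds of legs and density of the ends\<close>

lemma stabilizer_orbit_cofinal:
  assumes e: "e \<in> ends" and x: "x \<preceq> e" "x \<noteq> t" and y: "y \<preceq> e" "y \<noteq> e"
  obtains f where "autohom f" "f e = e" "\<not> f x \<preceq> y"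
proof (rule ccontr)
  assume "\<not> thesis"
  then have all: "\<And>f. autohom f \<Longrightarrow> f e = e \<Longrightarrow> f x \<preceq> y" using that by blast
  define B where "B = {f x |f. autohom f \<and> f e = e}"
  have yX: "y \<in> X" using below_X(1)[OF y(1)] .
  have "closure B \<subseteq> {c. c \<preceq> y}"
    using all by (intro closure_minimal closed_below[OF yX]) (auto simp: B_def)
  then have By: "c \<preceq> y" if "c \<in> closure B" for c using that by blast
  have xB: "x \<in> B"
    unfolding B_def by (intro CollectI exI[of _ "\<lambda>x. x"]) (use autohom_id in simp)
  \<comment> \<open>The closure of the orbit of \<open>x\<close> under the stabilizer of
    \<open>e\<close> is again invariant, so it must reach \<open>e\<close>.\<close>
  have "e \<in> closure B"
  proof (rule invariant_closed_max[OF e closed_closure])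
    show "c \<preceq> e" if "c \<in> closure B" for c using By[OF that] y(1) below_trans by blast
    show "f c \<in> closure B" if h: "autohom f" "f e = e" "c \<in> closure B" for f c
    proof -
      obtain s where s: "\<forall>n. s n \<in> B" "s \<longlonglongrightarrow> c" using h(3) unfolding closure_sequential by blast
      have BX: "B \<subseteq> X" using By closure_subset below_X by blast
      have "f (s n) \<in> B" for n
      proof -
        obtain k where k: "autohom k" "k e = e" "s n = k x" using s(1) unfolding B_def by blast
        then have "autohom (f \<circ> k)" "(f \<circ> k) e = e" "f (s n) = (f \<circ> k) x"
          using autohom_comp h by auto
        then show ?thesis unfolding B_def by blast
      qed
      moreover have "(\<lambda>n. f (s n)) \<longlonglongrightarrow> f c" using autohom_limit[OF h(1) _ s(2)] s(1) BX by blast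
      ultimately show ?thesis
        unfolding closure_sequential by (intro exI[of _ "\<lambda>n. f (s n)"]) simp
    qed
    show "x \<in> closure B" using xB closure_subset by blast
    show "x \<noteq> t" by (rule x(2))
  qed
  then show False using By ends_maximal[OF e] y(2) by blast
qed

lemma autohom_closure_ends:
  assumes f: "autohom f" and l: "l \<in> closure ends"
  shows "f l \<in> closure ends"
proof -
  obtain s where s: "\<forall>n. s n \<in> ends" "s \<longlonglongrightarrow> l" using l unfolding closure_sequential by blast
  have "(\<lambda>n. f (s n)) \<longlonglongrightarrow> f l" using autohom_limit[OF f _ s(2)] s(1) ends_X by blast
  then show ?thesis
    unfolding closure_sequential using s(1) autohom_ends[OF f] by (intro exI[of _ "\<lambda>n. f (s n)"]) simp
qed

text \<open>Such a pair is a fold: although \<open>x\<close> lies below \<open>p\<close>, there are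
  arcs from \<open>t\<close> that come close to \<open>p\<close> and afterwards close to
  \<open>x\<close>.\<close>

lemma nonsmooth_fold:
  assumes "x \<in> X" "x \<notin> smooth_points"
  obtains p where "p \<sqsubseteq> x" "x \<preceq> p" "x \<noteq> p"
proof -
  obtain p where p: "p \<sqsubseteq> x" "\<not> p \<preceq> x" using assms by (auto simp: smooth_points_def)
  then have "x \<preceq> p" using limit_below_comparable by blast
  moreover have "x \<noteq> p" using p(2) below_refl[OF assms(1)] by blast
  ultimately show thesis using that p(1) by blast
qed

text \<open>Moving along the arc from \<open>p\<close> to \<open>x\<close> turns
  \<open>p \<sqsubseteq> x\<close> into \<open>p \<sqsubseteq> c\<close>, although \<open>p\<close>
  is strictly above \<open>c\<close>.\<close>

lemma fold_nonsmooth: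
  assumes "p \<sqsubseteq> x" "x \<preceq> c" "c \<preceq> p" "c \<noteq> p"
  shows "c \<notin> smooth_points"
proof
  assume c: "c \<in> smooth_points"
  have xp: "x \<preceq> p" using below_trans[OF assms(2,3)] .
  then have "c \<in> seg p x"
    using mem_seg_iff_between[OF xp] assms(2,3) seg_sym[OF below_X[OF xp]] by simp
  then have "p \<sqsubseteq> c" using limit_below_seg(1)[OF assms(1)] by blast
  then have "p \<preceq> c" using c by (simp add: smooth_points_def)
  then show False using below_antisym[OF assms(3)] assms(4) by simp
qed


text \<open>Approximating an end \<open>e\<close> by ends of legs that follow a fold of its leg yields an arc with two
  more alternations: the fold is inserted between the visits before and after \<open>hi\<close>.\<close>

lemma fold_adds_alternations:
  assumes e: "e \<in> ends" and cl: "closure ends \<subseteq> insert t ends"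
    and lohi: "lo \<preceq> hi" "hi \<preceq> e" "lo \<noteq> hi" "hi \<sqsubseteq> lo"
    and PQ: "open P" "open Q" "lo \<in> P \<and> hi \<in> Q \<or> lo \<in> Q \<and> hi \<in> P"
    and alt: "alternating n P Q t e" and G: "open G" "e \<in> G"
  obtains e' where "e' \<in> ends" "e' \<in> G" "alternating (Suc (Suc n)) P Q t e'"
proof -
  have lo_e: "lo \<preceq> e" using below_trans[OF lohi(1,2)] .
  have hiX: "hi \<in> X" and loX: "lo \<in> X" using below_X[OF lohi(1)] by auto
  have lot: "lo \<noteq> t"
  proof
    assume "lo = t"
    then have "hi = t" using limit_below_top lohi(4) by simp
    then show False using \<open>lo = t\<close> lohi(3) by simp
  qed
  obtain H Y where HY: "\<And>k. H k \<preceq> Y k" "H \<longlonglongrightarrow> hi" "Y \<longlonglongrightarrow> lo"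
    using limit_belowE[OF lohi(4)] by metis
  have "\<forall>k. \<exists>e'. e' \<in> ends \<and> Y k \<preceq> e'"
    using below_end_any[OF below_X(2)[OF HY(1)]] by metis
  from choice[OF this] obtain E where E: "\<forall>k. E k \<in> ends \<and> Y k \<preceq> E k" by blast
  have EX: "E k \<in> X" for k using E ends_X by blast
  obtain q r where q: "q \<in> X" and r: "strict_mono (r :: nat \<Rightarrow> nat)" and Er: "(E \<circ> r) \<longlonglongrightarrow> q"
    by (rule subseq_X[OF EX])
  have Hr: "(H \<circ> r) \<longlonglongrightarrow> hi" and Yr: "(Y \<circ> r) \<longlonglongrightarrow> lo"
    using LIMSEQ_subseq_LIMSEQ r HY by blast+
  have HYr: "(H \<circ> r) k \<preceq> (Y \<circ> r) k" and YEr: "(Y \<circ> r) k \<preceq> (E \<circ> r) k" for k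
    using HY(1) E by simp_all
  have "q \<in> closure ends"
    unfolding closure_sequential using E Er by (intro exI[of _ "E \<circ> r"]) simp
  \<comment> \<open>The limit of the ends \<open>E k\<close> is an end, because
    \<open>lo \<sqsubseteq> q\<close> with \<open>lo \<noteq> t\<close>. As ends are smooth,
    \<open>lo\<close> lies on the leg of \<open>q\<close>, and that leg is the one of
    \<open>e\<close>.\<close>
  then have "q = t \<or> q \<in> ends" using cl by blast
  moreover have lq: "lo \<sqsubseteq> q" using limit_belowI[OF YEr Yr Er] .
  moreover have "q \<noteq> t" using limit_below_top lq lot by blast
  ultimately have qE: "q \<in> ends" by blast
  then have "lo \<preceq> q" using ends_smooth lq by (simp add: smooth_points_def)
  then have "q = e" using end_unique[OF lot qE e _ lo_e] by blast
  then have Ee: "(E \<circ> r) \<longlonglongrightarrow> e" using Er by simp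
  obtain i j where ij: "i + j = n" "alternating i P Q t hi"
    "alternating j (if even i then P else Q) (if even i then Q else P) hi e"
    by (rule alternating_split[OF alt base_below[OF hiX] lohi(2)])
  define S where "S = (if even i then P else Q)"
  define S' where "S' = (if even i then Q else P)"
  have SS: "open S" "open S'" "alternating j S S' hi e"
    using PQ(1,2) ij(3) by (auto simp: S_def S'_def)
  have 1: "eventually (\<lambda>k. alternating i P Q t ((H \<circ> r) k)) sequentially"
    by (rule alternating_eventually[OF ij(2) PQ(1,2) _ _ Hr])
      (use base_below[OF below_X(1)[OF HYr]] in auto)
  \<comment> \<open>After the visits up to \<open>hi\<close> the next one is due in
    \<open>S\<close>. Nearby legs pass near \<open>hi\<close>, return to \<open>lo\<close>, and
    climb past \<open>hi\<close> once more. If \<open>lo\<close> is in \<open>S\<close>, the two new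
    visits are at \<open>lo\<close> and at the second passage of \<open>hi\<close>; otherwise they
    are at the first passage \<open>H k\<close> and at \<open>lo\<close>.\<close>
  have 2: "eventually (\<lambda>k. alternating (Suc (Suc j)) S S' ((H \<circ> r) k) ((E \<circ> r) k)) sequentially"
  proof (cases "lo \<in> S \<and> hi \<in> S'")
    case True
    have "alternating (Suc (Suc j)) S S' lo e"
      using True lohi(1) SS(3) below_refl[OF loX] by auto
    then have "eventually (\<lambda>k. alternating (Suc (Suc j)) S S' ((Y \<circ> r) k) ((E \<circ> r) k)) sequentially"
      using alternating_eventually[OF _ SS(1,2) YEr Yr Ee] by blast
    then show ?thesis
      by eventually_elim (use alternating_mono_left HYr in blast)
  next
    case False
    then have lo_hi: "lo \<in> S'" "hi \<in> S" using PQ(3) by (auto simp: S_def S'_def split: if_splits)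
    have "alternating j S S' lo e" using alternating_mono_left[OF SS(3) lohi(1)] .
    then have "alternating (Suc j) S' S lo e" using lo_hi(1) below_refl[OF loX] by auto
    then have "eventually (\<lambda>k. alternating (Suc j) S' S ((Y \<circ> r) k) ((E \<circ> r) k)) sequentially"
      using alternating_eventually[OF _ SS(2,1) YEr Yr Ee] by blast
    moreover have "eventually (\<lambda>k. (H \<circ> r) k \<in> S) sequentially"
      by (rule topological_tendstoD[OF Hr SS(1) lo_hi(2)])
    ultimately show ?thesis
    proof eventually_elim
      case (elim k)
      have "alternating (Suc j) S' S ((H \<circ> r) k) ((E \<circ> r) k)"
        by (rule alternating_mono_left[OF elim(1) HYr])
      then show ?case
        using elim(2) below_refl[OF below_X(1)[OF HYr[of k]]]
        unfolding alternating.simps(2)[of "Suc j"] by blast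
    qed
  qed
  have 3: "eventually (\<lambda>k. (E \<circ> r) k \<in> G) sequentially"
    by (rule topological_tendstoD[OF Ee G])
  have "eventually (\<lambda>k. alternating (Suc (Suc n)) P Q t ((E \<circ> r) k) \<and> (E \<circ> r) k \<in> G) sequentially"
    using 1 2 3
  proof eventually_elim
    case (elim k)
    have "alternating (i + Suc (Suc j)) P Q t ((E \<circ> r) k)"
      using alternating_append[OF elim(1)] elim(2) unfolding S_def S'_def by blast
    then show ?case using elim(3) ij(1) by (simp del: alternating.simps)
  qed
  then obtain k where "alternating (Suc (Suc n)) P Q t ((E \<circ> r) k)" "(E \<circ> r) k \<in> G"
    using eventually_happens'[OF sequentially_bot] by blast
  moreover have "(E \<circ> r) k \<in> ends" using E by simp
  ultimately show thesis using that by blast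
qed

text \<open>The top, an end and \<open>s\<close> represent three orbits without nonsmooth points,
  which leaves a single orbit for these.\<close>

lemma nonsmooth_equivalent:
  assumes s: "s \<in> smooth_points" "s \<noteq> t" "s \<notin> ends"
    and x: "x \<in> X" "x \<notin> smooth_points" and y: "y \<in> X" "y \<notin> smooth_points"
  shows "equivalent x y"
proof (rule ccontr)
  assume "\<not> equivalent x y"
  obtain e where e: "e \<in> ends" by (rule exists_end)
  have sX: "s \<in> X" using s(1) by (simp add: smooth_points_def)
  have ne: "x \<noteq> t" "x \<notin> ends" "y \<noteq> t" "y \<notin> ends"
    using x y top_smooth ends_smooth by auto
  have sn: "\<not> equivalent s z" if "z \<notin> smooth_points" for z
    using that s(1) autohom_smooth_points_iff[OF _ sX] by (auto elim!: equivalentE)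
  have "set [t, e, s, x, y] \<subseteq> X" using base ends_X[OF e] sX x(1) y(1) by simp
  then show False
    using five_points[of "[t, e, s, x, y]"] \<open>\<not> equivalent x y\<close> not_equivalent_top[OF ends_ne_top[OF e]]
      not_equivalent_top[OF s(2)] not_equivalent_top[OF ne(1)] not_equivalent_top[OF ne(3)]
      not_equivalent_end[OF e s(3)] not_equivalent_end[OF e ne(2)] not_equivalent_end[OF e ne(4)]
      sn[OF x(2)] sn[OF y(2)] by simp
qed

text \<open>The top, an end and the nonsmooth \<open>x\<close> represent three orbits, which leaves
  a single orbit for the smooth inner points.\<close>

lemma smooth_equivalent:
  assumes x: "x \<in> X" "x \<notin> smooth_points"
    and s: "s \<in> smooth_points" "s \<noteq> t" "s \<notin> ends"
    and s': "s' \<in> smooth_points" "s' \<noteq> t" "s' \<notin> ends"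
  shows "equivalent s s'"
proof (rule ccontr)
  assume "\<not> equivalent s s'"
  obtain e where e: "e \<in> ends" by (rule exists_end)
  have sX: "s \<in> X" "s' \<in> X" using s(1) s'(1) by (auto simp: smooth_points_def)
  have ne: "x \<noteq> t" "x \<notin> ends" using x top_smooth ends_smooth by auto
  have sn: "\<not> equivalent z x" if "z \<in> smooth_points" for z
    using that x(2) autohom_smooth_points_iff[of _ z] by (auto elim!: equivalentE simp: smooth_points_def)
  have "set [t, e, s, s', x] \<subseteq> X" using base ends_X[OF e] sX x(1) by simp
  then show False
    using five_points[of "[t, e, s, s', x]"] \<open>\<not> equivalent s s'\<close> not_equivalent_top[OF ends_ne_top[OF e]]
      not_equivalent_top[OF s(2)] not_equivalent_top[OF s'(2)] not_equivalent_top[OF ne(1)]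
      not_equivalent_end[OF e s(3)] not_equivalent_end[OF e s'(3)] not_equivalent_end[OF e ne(2)]
      sn[OF s(1)] sn[OF s'(1)] by simp
qed

text \<open>Otherwise the nonsmooth points would fill, from \<open>n\<close> on, a compact piece of their leg, although
  by the fold at its last point they continue beyond it.\<close>

lemma closure_ends_smooth:
  assumes s: "s \<in> smooth_points" "s \<noteq> t" "s \<notin> closure ends"
    and n: "n \<in> X" "n \<notin> smooth_points"
  shows "n \<notin> closure ends"
proof
  assume ncl: "n \<in> closure ends"
  have s_ends: "s \<notin> ends" using s(3) closure_subset by blast
  have sX: "s \<in> X" using s(1) by (simp add: smooth_points_def)
  have N_cl: "x \<in> closure ends" if x: "x \<in> X" "x \<notin> smooth_points" for x
  proof -
    obtain f where f: "autohom f" "f n = x"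
      by (rule equivalentE[OF nonsmooth_equivalent[OF s(1,2) s_ends n x]])
    then show ?thesis using autohom_closure_ends[OF f(1) ncl] by simp
  qed
  have S_cl: "x \<notin> closure ends" if x: "x \<in> smooth_points" "x \<noteq> t" "x \<notin> ends" for x
  proof
    assume xcl: "x \<in> closure ends"
    obtain f where f: "autohom f" "f x = s"
      by (rule equivalentE[OF smooth_equivalent[OF n x s(1,2) s_ends]])
    then show False using autohom_closure_ends[OF f(1) xcl] s(3) by simp
  qed
  have nt: "n \<noteq> t" "n \<notin> ends" using n top_smooth ends_smooth by auto
  obtain e where e: "e \<in> ends" "n \<preceq> e" by (rule below_end[OF n(1) nt(1)])
  have ne: "n \<noteq> e" using nt(2) e(1) by blast
  obtain e' where e': "e' \<in> ends" "s \<preceq> e'" by (rule below_end[OF sX s(2)])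
  obtain f where f: "autohom f" "f e' = e" by (rule equivalentE[OF ends_equivalent[OF e'(1) e(1)]])
  have orb: "h s \<in> smooth_points \<and> h s \<noteq> t \<and> h s \<notin> ends" if h: "autohom h" for h
  proof -
    obtain g where g: "autohom g" "\<And>x. x \<in> X \<Longrightarrow> g (h x) = x"
      using autohom_inverse[OF h] by metis
    have gs: "g (h s) = s" using g(2)[OF sX] .
    have "h s \<noteq> t" using gs autohom_top[OF g(1)] s(2) by metis
    moreover have "h s \<notin> ends" using gs autohom_ends[OF g(1)] s_ends by metis
    ultimately show ?thesis using autohom_smooth_points_iff[OF h sX] s(1) by simp
  qed
  have s1: "f s \<preceq> e" "f s \<noteq> t" using autohom_below[OF f(1) e'(2)] f(2) orb[OF f(1)] by auto
  \<comment> \<open>Pushes a smooth inner point of the leg beyond \<open>n\<close>; being equivalent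
    to \<open>s\<close>, it is not a limit of ends and bounds the piece to be studied.\<close>
  obtain h where h: "autohom h" "h e = e" "\<not> h (f s) \<preceq> n"
    by (rule stabilizer_orbit_cofinal[OF e(1) s1 e(2) ne])
  define z where "z = h (f s)"
  have z: "z \<in> smooth_points" "z \<noteq> t" "z \<notin> ends"
    using orb[OF autohom_comp[OF f(1) h(1)]] by (auto simp: z_def)
  have "z \<preceq> e" using autohom_below[OF h(1) s1(1)] h(2) by (simp add: z_def)
  then have nz: "n \<preceq> z" using below_linear[OF e(2)] h(3) by (auto simp: z_def)
  let ?A = "seg n z \<inter> closure ends"
  have X: "n \<in> X" "z \<in> X" using below_X[OF nz] by auto
  have "closed ?A" using seg_closed[OF X] by auto
  moreover have "n \<in> ?A" using ncl seg_ends(1)[OF X] by blast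
  ultimately obtain m where m: "m \<in> ?A" "?A \<subseteq> seg n m"
    using closed_subset_seg_max[OF X, of ?A] by blast
  have nm: "n \<preceq> m" "m \<preceq> z" using m(1) mem_seg_iff_between[OF nz] by auto
  have mX: "m \<in> X" using below_X[OF nm(1)] by simp
  have mt: "m \<noteq> t" using nm(1) nt(1) below_antisym base_below[OF n(1)] by blast
  have "m \<noteq> z" using m(1) S_cl[OF z] by blast
  have m_ends: "m \<notin> ends" using not_end_of_below[OF nm(2) \<open>m \<noteq> z\<close>] .
  have m_ns: "m \<notin> smooth_points" using S_cl[OF _ mt m_ends] m(1) by blast
  obtain p where p: "p \<sqsubseteq> m" "m \<preceq> p" "m \<noteq> p" by (rule nonsmooth_fold[OF mX m_ns])
  \<comment> \<open>A smooth point on a fold can only be its upper end, so the fold at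
    \<open>m\<close> does not reach beyond \<open>z\<close>.\<close>
  have "\<not> z \<preceq> p \<or> z = p"
    using fold_nonsmooth[OF p(1) nm(2)] z(1) by blast
  then have pz: "p \<preceq> z"
    using below_comparable[OF mt p(2) nm(2)] by auto
  obtain c where c: "m \<preceq> c" "c \<preceq> p" "c \<noteq> m" "c \<noteq> p" by (rule inner_point[OF p(2,3)])
  have "c \<notin> smooth_points" by (rule fold_nonsmooth[OF p(1) c(1,2,4)])
  then have "c \<in> closure ends" using N_cl below_X(1)[OF c(2)] by blast
  moreover have "c \<in> seg n z"
    using mem_seg_iff_between[OF nz] below_trans[OF nm(1) c(1)] below_trans[OF c(2) pz] by simp
  ultimately have "c \<in> seg n m" using m(2) by blast
  then have "c \<preceq> m" using mem_seg_iff_between[OF nm(1)] by simp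
  then show False using c(1,3) below_antisym by blast
qed

text \<open>If the ends are nowhere dense, then nearby ends have nearby legs and every leg has a fold.
  By Baire's theorem the folds of an open set of legs all join two fixed disjoint balls, and adding
  fold after fold leads to an arc oscillating infinitely often between them.\<close>

lemma closure_ends:
  assumes n: "n \<in> X" "n \<notin> smooth_points"
  shows "X \<subseteq> closure ends"
proof (rule ccontr)
  assume "\<not> X \<subseteq> closure ends"
  then have "(- closure ends) \<inter> X \<noteq> {}" by blast
  \<comment> \<open>The smooth point to be found must differ from \<open>t\<close>. If
    \<open>t\<close> were the only point outside the closure of the ends, \<open>{t}\<close> would
    be open and closed in the connected \<open>X\<close>.\<close>
  have "(- closure ends \<inter> - {t}) \<inter> X \<noteq> {}"
  proof
    assume emp: "(- closure ends \<inter> - {t}) \<inter> X = {}"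
    obtain e where e: "e \<in> ends" by (rule exists_end)
    have "e \<in> - {t} \<inter> X" using ends_X[OF e] ends_ne_top[OF e] by simp
    then show False
      using connectedD[OF connected_X, of "- closure ends" "- {t}"] emp \<open>(- closure ends) \<inter> X \<noteq> {}\<close>
      by (auto simp: open_Compl)
  qed
  then have "(- closure ends \<inter> - {t}) \<inter> smooth_points \<noteq> {}"
    by (intro smooth_points_dense) auto
  then obtain s where s: "s \<in> smooth_points" "s \<noteq> t" "s \<notin> closure ends" by blast
  have s_ends: "s \<notin> ends" using s(3) closure_subset by blast
  define C where "C = closure ends"
  have CX: "C \<subseteq> X"
    unfolding C_def using ends_X compact_imp_closed[OF compact_X] by (intro closure_minimal) auto
  have Cc: "compact C" and Ccl: "closed C"
    using compact_X CX unfolding C_def by (metis closed_closure compact_Int_closed inf.absorb_iff2) simp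
  have CS: "C \<subseteq> smooth_points" using closure_ends_smooth[OF s] CX unfolding C_def by blast
  have Ct: "C \<subseteq> insert t ends"
  proof
    fix l assume l: "l \<in> C"
    show "l \<in> insert t ends"
    proof (rule ccontr)
      assume "l \<notin> insert t ends"
      then have "equivalent l s" using smooth_equivalent[OF n _ _ _ s(1,2) s_ends, of l] CS l by blast
      then obtain f where f: "autohom f" "f l = s" by (rule equivalentE)
      then show False using autohom_closure_ends[OF f(1), of l] l s(3) by (simp add: C_def)
    qed
  qed
  have fold: "\<exists>x p. x \<preceq> p \<and> x \<noteq> p \<and> p \<preceq> e \<and> p \<sqsubseteq> x" if e: "e \<in> ends" for e
  proof -
    obtain p where p: "p \<sqsubseteq> n" "n \<preceq> p" "n \<noteq> p" by (rule nonsmooth_fold[OF n])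
    obtain e0 where e0: "e0 \<in> ends" "p \<preceq> e0" by (rule below_end_any[OF limit_below_X(1)[OF p(1)]])
    obtain f where f: "autohom f" "f e0 = e" by (rule equivalentE[OF ends_equivalent[OF e0(1) e]])
    have "f n \<noteq> f p"
      using inj_onD[OF autohom_inj[OF f(1)]] below_X[OF p(2)] p(3) by blast
    then show ?thesis
      using autohom_below[OF f(1) p(2)] autohom_below[OF f(1) e0(2)] f(2)
        autohom_limit_below[OF f(1) p(1)] by metis
  qed
  define r where "r k = inverse (real (Suc k))" for k
  have r: "r k > 0" for k by (simp add: r_def)
  \<comment> \<open>Limits of end points whose arcs carry a fold between the balls about
    \<open>a\<close> and \<open>b\<close>. Limits may forget which of \<open>x\<close> and
    \<open>p\<close> is lower, so both limit relations are required; the order is recovered later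
    from linearity below the end.\<close>
  define T where "T = (\<lambda>(a, b, k). {q \<in> C. \<exists>x p. x \<preceq> q \<and> p \<preceq> q \<and> dist a x \<le> r k \<and> dist b p \<le> r k
      \<and> x \<sqsubseteq> p \<and> p \<sqsubseteq> x})"
  have Tcl: "closed (T (a, b, k))" for a b k
    unfolding closed_sequential_limits
  proof (intro allI impI)
    fix u l assume u: "(\<forall>n. u n \<in> T (a, b, k)) \<and> u \<longlonglongrightarrow> l"
    then have "\<forall>n. u n \<in> C" by (auto simp: T_def)
    then have lC: "l \<in> C" using closed_sequentially[OF Ccl] u by blast
    have "\<forall>n. \<exists>y. fst y \<preceq> u n \<and> snd y \<preceq> u n \<and> dist a (fst y) \<le> r k \<and> dist b (snd y) \<le> r k
        \<and> fst y \<sqsubseteq> snd y \<and> snd y \<sqsubseteq> fst y"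
      using u by (fastforce simp: T_def)
    from choice[OF this] obtain y where y:
      "\<forall>n. fst (y n) \<preceq> u n \<and> snd (y n) \<preceq> u n \<and> dist a (fst (y n)) \<le> r k \<and> dist b (snd (y n)) \<le> r k
        \<and> fst (y n) \<sqsubseteq> snd (y n) \<and> snd (y n) \<sqsubseteq> fst (y n)" by blast
    have "\<forall>n. y n \<in> X \<times> X" using y below_X(1) unfolding mem_Times_iff by blast
    then obtain z g where z: "strict_mono (g :: nat \<Rightarrow> nat)" "(y \<circ> g) \<longlonglongrightarrow> z"
      using seq_compactE[OF compact_imp_seq_compact[OF compact_Times[OF compact_X compact_X]]] by metis
    have f: "(\<lambda>n. fst (y (g n))) \<longlonglongrightarrow> fst z" and sn: "(\<lambda>n. snd (y (g n))) \<longlonglongrightarrow> snd z"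
      using tendsto_fst[OF z(2)] tendsto_snd[OF z(2)] by simp_all
    have ug: "(\<lambda>n. u (g n)) \<longlonglongrightarrow> l"
      using LIMSEQ_subseq_LIMSEQ[of u l g] u z(1) by (simp add: o_def)
    have "fst z \<sqsubseteq> l" by (rule limit_belowI[OF _ f ug]) (use y in blast)
    moreover have "snd z \<sqsubseteq> l" by (rule limit_belowI[OF _ sn ug]) (use y in blast)
    \<comment> \<open>Passing to the limit gives only \<open>\<sqsubseteq>\<close>; it is smoothness
      of \<open>l\<close>, a point of \<open>C\<close>, that restores
      \<open>\<preceq>\<close>.\<close>
    ultimately have "fst z \<preceq> l" "snd z \<preceq> l" using lC CS by (auto simp: smooth_points_def)
    moreover have "fst z \<sqsubseteq> snd z" by (rule limit_below_closed[OF _ f sn]) (use y in blast)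
    moreover have "snd z \<sqsubseteq> fst z" by (rule limit_below_closed[OF _ sn f]) (use y in blast)
    moreover have "dist a (fst z) \<le> r k"
      by (rule LIMSEQ_le_const2[OF tendsto_dist[OF tendsto_const f]]) (use y in blast)
    moreover have "dist b (snd z) \<le> r k"
      by (rule LIMSEQ_le_const2[OF tendsto_dist[OF tendsto_const sn]]) (use y in blast)
    ultimately show "l \<in> T (a, b, k)" using lC by (auto simp: T_def)
  qed
  obtain D where D: "countable D" "\<And>y r. y \<in> X \<Longrightarrow> r > 0 \<Longrightarrow> \<exists>d\<in>D. dist d y < r"
    using compact_countable_dense_subset[OF compact_X] by metis
  \<comment> \<open>The factor 4 leaves room for the radii \<open>3/2 * r k\<close> of
    \<open>U\<close> and \<open>V\<close> and a gap of at least \<open>r k\<close> between them. It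
    is attainable because \<open>r k < dist x p / 6\<close> and the centres are within
    \<open>r k\<close> of \<open>x\<close> and \<open>p\<close>.\<close>
  define I where "I = {(a, b, k). a \<in> D \<and> b \<in> D \<and> 4 * r k < dist a b}"
  have "I \<subseteq> D \<times> D \<times> UNIV" by (auto simp: I_def)
  then have Ic: "countable I" by (rule countable_subset) (use D(1) in auto)
  \<comment> \<open>The top may be a limit of ends without being one, so it gets a member of its
    own. That member is ruled out afterwards, since every open set meeting \<open>C\<close> contains
    an end.\<close>
  have cover: "C \<subseteq> \<Union> (insert {t} (T ` I))"
  proof
    fix q assume q: "q \<in> C"
    show "q \<in> \<Union> (insert {t} (T ` I))"
    proof (cases "q = t")
      case False
      then have "q \<in> ends" using q Ct by blast
      then obtain x p where xp: "x \<preceq> p" "x \<noteq> p" "p \<preceq> q" "p \<sqsubseteq> x" using fold by blast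
      obtain k where k: "r k < dist x p / 6"
        using reals_Archimedean[of "dist x p / 6"] xp(2) by (auto simp: r_def)
      obtain a where a: "a \<in> D" "dist a x < r k" using D(2)[OF below_X(1)[OF xp(1)] r] by blast
      obtain b where b: "b \<in> D" "dist b p < r k" using D(2)[OF below_X(2)[OF xp(1)] r] by blast
      have "dist x p \<le> dist a x + dist a b + dist b p" by metric
      then have "4 * r k < dist a b" using a(2) b(2) k by simp
      then have "(a, b, k) \<in> I" using a(1) b(1) by (simp add: I_def)
      moreover have "x \<preceq> q \<and> p \<preceq> q \<and> dist a x \<le> r k \<and> dist b p \<le> r k \<and> x \<sqsubseteq> p \<and> p \<sqsubseteq> x"
        using xp(3,4) below_trans[OF xp(1,3)] a(2) b(2) below_imp_limit_below[OF xp(1)] by simp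
      then have "q \<in> T (a, b, k)" using q unfolding T_def by blast
      ultimately show ?thesis by blast
    qed simp
  qed
  have Cne: "C \<noteq> {}" unfolding C_def using exists_end closure_subset by (metis closure_eq_empty empty_iff)
  obtain F W where W: "F \<in> insert {t} (T ` I)" "open W" "W \<inter> C \<noteq> {}" "W \<inter> C \<subseteq> F"
  proof (rule compact_Baire_closed_cover[OF Cc Cne _ cover])
    show "countable (insert {t} (T ` I))" using Ic by simp
    show "closed S" if "S \<in> insert {t} (T ` I)" for S
      using that Tcl by auto
  qed
  have meets: "G \<inter> ends \<noteq> {}" if "open G" "G \<inter> C \<noteq> {}" for G
    using that open_Int_closure_eq_empty[of G ends] by (simp add: C_def)
  have endsC: "ends \<subseteq> C" unfolding C_def by (rule closure_subset)
  obtain e0 where e0: "e0 \<in> W" "e0 \<in> ends" using meets[OF W(2,3)] by blast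
  have "F \<noteq> {t}" using e0 endsC W(4) ends_ne_top by blast
  then obtain a b k where abk: "(a, b, k) \<in> I" "W \<inter> C \<subseteq> T (a, b, k)"
    using W(1,4) by auto
  have dab: "4 * r k < dist a b" using abk(1) by (simp add: I_def)
  \<comment> \<open>The radius exceeds \<open>r k\<close>, so that the closed conditions in
    \<open>T\<close> put \<open>x\<close> and \<open>p\<close> inside open sets, as chains
    require.\<close>
  define U where "U = ball a (3 / 2 * r k)"
  define V where "V = ball b (3 / 2 * r k)"
  have UV: "open U" "open V" by (simp_all add: U_def V_def)
  have sep: "r k \<le> dist u v" if "u \<in> U" "v \<in> V" for u v
  proof -
    have "dist a b \<le> dist a u + dist u v + dist b v" by metric
    then show ?thesis using that dab by (simp add: U_def V_def)
  qed
  have step: "\<exists>e'\<in>ends \<inter> G. alternating (Suc (Suc m)) U V t e'"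
    if e: "e \<in> ends" "e \<in> W" and G: "open G" "e \<in> G" and alt: "alternating m U V t e" for e G m
  proof -
    have "e \<in> T (a, b, k)" using e endsC abk(2) by blast
    then obtain x p where xp: "x \<preceq> e" "p \<preceq> e" "dist a x \<le> r k" "dist b p \<le> r k" "x \<sqsubseteq> p" "p \<sqsubseteq> x"
      by (auto simp: T_def)
    have xU: "x \<in> U" and pV: "p \<in> V" using xp(3,4) r[of k] by (auto simp: U_def V_def)
    have ne: "x \<noteq> p" using sep[OF xU pV] r[of k] by auto
    have cl': "closure ends \<subseteq> insert t ends" using Ct by (simp add: C_def)
    show ?thesis
    proof (cases "x \<preceq> p")
      case True
      obtain e' where "e' \<in> ends" "e' \<in> G" "alternating (Suc (Suc m)) U V t e'"
        by (rule fold_adds_alternations[OF e(1) cl' True xp(2) ne xp(6) UV _ alt G]) (use xU pV in simp)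
      then show ?thesis by blast
    next
      case False
      then have px: "p \<preceq> x" using below_linear[OF xp(1,2)] by blast
      obtain e' where "e' \<in> ends" "e' \<in> G" "alternating (Suc (Suc m)) U V t e'"
        by (rule fold_adds_alternations[OF e(1) cl' px xp(1) ne[symmetric] xp(5) UV _ alt G])
          (use xU pV in simp)
      then show ?thesis by blast
    qed
  qed
  have dense: "\<exists>e\<in>ends \<inter> G. alternating (2 * m) U V t e"
    if G: "open G" "G \<subseteq> W" "G \<inter> C \<noteq> {}" for G m
  proof (induction m)
    case 0
    obtain e where "e \<in> G" "e \<in> ends" using meets[OF G(1,3)] by blast
    then show ?case using base_below[OF ends_X] by auto
  next
    case (Suc m)
    then obtain e where e: "e \<in> ends" "e \<in> G" "alternating (2 * m) U V t e" by blast
    then show ?case using step[OF e(1) _ G(1) e(2,3)] G(2) by (auto simp del: alternating.simps)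
  qed
  let ?H = "\<lambda>m. {x \<in> C. alternating (2 * m) U V t x}"
  obtain x where x: "x \<in> W" "x \<in> C" "\<And>S. S \<in> range ?H \<Longrightarrow> x \<in> S"
  proof (rule compact_Baire_dense_open[OF Cc W(2,3), of "range ?H"])
    show "countable (range ?H)" by simp
    show "openin (top_of_set C) S" if "S \<in> range ?H" for S
      using that openin_alternating[OF UV CX] by blast
    show "G \<inter> S \<noteq> {}" if "S \<in> range ?H" "open G" "G \<subseteq> W" "G \<inter> C \<noteq> {}" for S G
      using that(1) dense[OF that(2-4)] endsC by blast
  qed blast
  have xX: "x \<in> X" using x(2) CX by blast
  obtain N where N: "\<And>m. alternating m U V t x \<Longrightarrow> m \<le> N"
    using alternating_bounded[OF r sep xX] by blast
  have "alternating (2 * Suc N) U V t x" using x(3) by blast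
  then show False using N[of "2 * Suc N"] by simp
qed

end

theorem theorem5p4:
  fixes X :: "'a::metric_space set" and t :: 'a
  assumes "fan X" and "t = fan_top X"
    and "\<not> smooth X"
    and "fractionally_homogeneous 4 X"
  shows "(\<forall>p\<in>end_points X. colocally_connected_at X p)
       \<and> (top_of_set X) closure_of (end_points X) = X
       \<and> end_points X \<union> {t} \<subseteq> smooth_set X"
proof -
  have ex1: "\<exists>!t. ramification_point X t" using assms(1) by (simp add: fan_def)
  have "ramification_point X t"
    unfolding assms(2) fan_top_def by (rule theI'[OF ex1])
  then have tX: "t \<in> X" by (simp add: ramification_point_def)
  have dX: "dendroid X" using assms(1) by (simp add: fan_def)
  interpret four_orbit_fan X t
    by unfold_locales (fact dX tX assms)+
  obtain n where n: "n \<in> X" "\<not> smooth_at_wrt X t n"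
    using assms(3) tX unfolding smooth_def by blast
  then have "n \<notin> smooth_points" using smooth_points_smooth_at by blast
  then have dense: "X \<subseteq> closure ends" using closure_ends[OF n(1)] by blast
  have eX: "ends \<subseteq> X" using ends_X by blast
  have "(top_of_set X) closure_of ends = X"
    using dense eX by (simp add: closure_of_subtopology Int_absorb1 Int_absorb2)
  moreover have "ends \<union> {t} \<subseteq> smooth_set X"
    using ends_smooth top_smooth smooth_points_smooth_at eX tX assms(2)
    unfolding smooth_set_def by auto
  ultimately show ?thesis
    unfolding end_points_eq using colocally_connected_at_end by blast
qed

end
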